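(* Let $S=\Gamma\backslash\mathbb H$ be a hyperbolic surface with at least one cusp and let $u\in T^1S$ be cusp-recurrent. Then (1) $H^{ss}u\subsetneq W^{ss}u$; (2) $W^{ss}u$ is a union of uncountably many pairwise distinct stable horocycles $H^{ss}v_i$.
   Context: $\mathbb H$ is the upper half-plane with hyperbolic distance $d$, boundary $\partial\mathbb H=\mathbb R\cup\{\infty\}$. For $v\in T^1\mathbb H$, $t\mapsto v(t)$ is the unit-speed geodesic with initial vector $v$, $g_tv$ its tangent vector at time $t$, and $v(\pm\infty)\in\partial\mathbb H$ its endpoints. Busemann function: for $\xi\in\partial\mathbb H$ and a geodesic ray $c$ converging to $\xi$, $B_\xi(x,y)=\lim_{t\to\infty}(d(x,c(t))-d(y,c(t)))$. Stable horocycle: $H^{ss}v=\{w\in T^1\mathbb H: w(+\infty)=v(+\infty),\ B_{v(+\infty)}(w(0),v(0))=0\}$; $H^{ws}v=\{w: w(+\infty)=v(+\infty)\}$. $\Gamma$ is a torsion-free Fuchsian group, $S=\Gamma\backslash\mathbb H$, $T^1S=\Gamma\backslash T^1\mathbb H$; $H^{ss}$, $H^{ws}$ descend to $T^1S$. On $T^1\mathbb H$, $d_1(v,w)=d(v(0),w(0))+d(v(1),w(1))$; on $T^1S$, $d_1(u,v)=\inf_{\gamma\in\Gamma}d_1(\tilde u,\gamma\tilde v)$ (equivalent to Sasaki distance). Strong-stable set: $W^{ss}u=\{v\in T^1S:\lim_{t\to+\infty}d_1(g_tu,g_tv)=0\}$. A closed horocycle in $S$ is the projection of a horocycle centered at the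 fixed point of a parabolic element of $\Gamma$. A vector $u\in T^1S$ is cusp-recurrent if the geodesic ray $u(\mathbb R^+)$ does not escape to infinity through a cusp (equivalently, for a lift $\tilde u$, $\tilde u(+\infty)$ is not fixed by any parabolic element of $\Gamma$) and there exist closed horocycles $H_n$ in $S$ with lengths tending to $0$ and times $t_n\ge0$ with $u(t_n)\in H_n$. *)

theory Defs
  imports "HOL-Analysis.Analysis"
begin

section \<open>Upper half-plane, hyperbolic distance, boundary\<close>

definition HH :: "complex set" where
  "HH = {z. Im z > 0}"

definition hdist :: "complex \<Rightarrow> complex \<Rightarrow> real" where
  "hdist z w = arcosh (1 + (cmod (z - w))\<^sup>2 / (2 * Im z * Im w))"

text \<open>Boundary points: Some x is the real point x, None is the point at infinity.\<close>
type_synonym bdry = "real option"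

definition tends_bdry :: "(real \<Rightarrow> complex) \<Rightarrow> bdry \<Rightarrow> bool" where
  "tends_bdry c \<xi> = (case \<xi> of
      Some x \<Rightarrow> (c \<longlongrightarrow> complex_of_real x) at_top
    | None \<Rightarrow> filterlim (\<lambda>t. cmod (c t)) at_top at_top)"

definition tends_bdry_minus :: "(real \<Rightarrow> complex) \<Rightarrow> bdry \<Rightarrow> bool" where
  "tends_bdry_minus c \<xi> = (case \<xi> of
      Some x \<Rightarrow> (c \<longlongrightarrow> complex_of_real x) at_bot
    | None \<Rightarrow> filterlim (\<lambda>t. cmod (c t)) at_top at_bot)"

section \<open>Unit tangent bundle and geodesic flow\<close>

text \<open>A tangent vector at z is a pair (z, w); it has hyperbolic norm cmod w / Im z,
  so unit vectors satisfy cmod w = Im z.\<close>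
definition T1H :: "(complex \<times> complex) set" where
  "T1H = {(z, w). z \<in> HH \<and> cmod w = Im z}"

text \<open>The unit-speed geodesic with initial vector v.\<close>
definition geod :: "complex \<times> complex \<Rightarrow> real \<Rightarrow> complex" where
  "geod v = (THE c. c 0 = fst v \<and> (c has_vector_derivative snd v) (at 0) \<and>
       (\<forall>s t. c s \<in> HH \<and> hdist (c s) (c t) = \<bar>s - t\<bar>))"

text \<open>Geodesic flow: g_t v is the tangent vector of the geodesic at time t.\<close>
definition gflow :: "real \<Rightarrow> complex \<times> complex \<Rightarrow> complex \<times> complex" where
  "gflow t v = (geod v t, vector_derivative (geod v) (at t))"

definition vplus :: "complex \<times> complex \<Rightarrow> bdry" where
  "vplus v = (THE \<xi>. tends_bdry (geod v) \<xi>)"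

definition vminus :: "complex \<times> complex \<Rightarrow> bdry" where
  "vminus v = (THE \<xi>. tends_bdry_minus (geod v) \<xi>)"

section \<open>Busemann functions, horocycles\<close>

definition georay :: "(real \<Rightarrow> complex) \<Rightarrow> bool" where
  "georay c = (\<forall>s t. s \<ge> 0 \<longrightarrow> t \<ge> 0 \<longrightarrow> c s \<in> HH \<and> hdist (c s) (c t) = \<bar>s - t\<bar>)"

definition busemann :: "bdry \<Rightarrow> complex \<Rightarrow> complex \<Rightarrow> real" where
  "busemann \<xi> x y = (THE L. \<forall>c. georay c \<and> tends_bdry c \<xi> \<longrightarrow>
       ((\<lambda>t. hdist x (c t) - hdist y (c t)) \<longlongrightarrow> L) at_top)"

text \<open>Strong stable horocycle H^ss v in T^1 H.\<close>
definition Hss :: "complex \<times> complex \<Rightarrow> (complex \<times> complex) set" where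
  "Hss v = {w \<in> T1H. vplus w = vplus v \<and> busemann (vplus v) (fst w) (fst v) = 0}"

text \<open>Horocycle (as a set of points of HH) centered at xi passing through z.\<close>
definition horocycle :: "bdry \<Rightarrow> complex \<Rightarrow> complex set" where
  "horocycle \<xi> z = {w \<in> HH. busemann \<xi> w z = 0}"

text \<open>d_1 on T^1 H.\<close>
definition d1 :: "complex \<times> complex \<Rightarrow> complex \<times> complex \<Rightarrow> real" where
  "d1 v w = hdist (geod v 0) (geod w 0) + hdist (geod v 1) (geod w 1)"

text \<open>Length of a path in HH, as a metric (hyperbolic) length on [0,1].\<close>
definition hlength :: "(real \<Rightarrow> complex) \<Rightarrow> real" where
  "hlength p = Sup {(\<Sum>i<n. hdist (p (ts i)) (p (ts (Suc i)))) | n ts.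
      ts 0 = 0 \<and> ts n = 1 \<and> (\<forall>i<n. ts i \<le> ts (Suc i))}"

section \<open>Fuchsian groups (as subgroups of SL(2,R), acting through PSL(2,R))\<close>

definition mob :: "real^2^2 \<Rightarrow> complex \<Rightarrow> complex" where
  "mob A z = (complex_of_real (A$1$1) * z + complex_of_real (A$1$2)) /
             (complex_of_real (A$2$1) * z + complex_of_real (A$2$2))"

text \<open>Action on tangent vectors: derivative of mob A at z is 1/(cz+d)^2.\<close>
definition tact :: "real^2^2 \<Rightarrow> complex \<times> complex \<Rightarrow> complex \<times> complex" where
  "tact A v = (mob A (fst v),
     snd v / (complex_of_real (A$2$1) * fst v + complex_of_real (A$2$2))\<^sup>2)"

text \<open>Action on the boundary R \<union> {infinity}.\<close>
definition bact :: "real^2^2 \<Rightarrow> bdry \<Rightarrow> bdry" where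
  "bact A \<xi> = (case \<xi> of
      Some x \<Rightarrow> (if A$2$1 * x + A$2$2 = 0 then None
                 else Some ((A$1$1 * x + A$1$2) / (A$2$1 * x + A$2$2)))
    | None \<Rightarrow> (if A$2$1 = 0 then None else Some (A$1$1 / A$2$1)))"

definition is_pm_id :: "real^2^2 \<Rightarrow> bool" where
  "is_pm_id A \<longleftrightarrow> A = mat 1 \<or> A = - mat 1"

definition fuchsian :: "(real^2^2) set \<Rightarrow> bool" where
  "fuchsian \<Gamma> \<longleftrightarrow>
     (\<forall>A\<in>\<Gamma>. det A = 1) \<and> mat 1 \<in> \<Gamma> \<and>
     (\<forall>A\<in>\<Gamma>. \<forall>B\<in>\<Gamma>. A ** B \<in> \<Gamma>) \<and> (\<forall>A\<in>\<Gamma>. matrix_inv A \<in> \<Gamma>) \<and>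
     (\<forall>A\<in>\<Gamma>. \<exists>e>0. \<forall>B\<in>\<Gamma>. dist A B < e \<longrightarrow> B = A)"

definition torsion_free :: "(real^2^2) set \<Rightarrow> bool" where
  "torsion_free \<Gamma> \<longleftrightarrow>
     (\<forall>A\<in>\<Gamma>. \<forall>n::nat. n > 0 \<longrightarrow> is_pm_id (((**) A ^^ n) (mat 1)) \<longrightarrow> is_pm_id A)"

definition parabolic :: "real^2^2 \<Rightarrow> bool" where
  "parabolic A \<longleftrightarrow> \<bar>A$1$1 + A$2$2\<bar> = 2 \<and> \<not> is_pm_id A"

definition parabolic_fixed :: "(real^2^2) set \<Rightarrow> bdry \<Rightarrow> bool" where
  "parabolic_fixed \<Gamma> \<xi> \<longleftrightarrow> (\<exists>A\<in>\<Gamma>. parabolic A \<and> bact A \<xi> = \<xi>)"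

section \<open>The quotient T^1 S, represented by Gamma-orbits\<close>

definition orbit :: "(real^2^2) set \<Rightarrow> complex \<times> complex \<Rightarrow> (complex \<times> complex) set" where
  "orbit \<Gamma> v = (\<lambda>A. tact A v) ` \<Gamma>"

text \<open>d_1 on T^1 S, in terms of lifts.\<close>
definition d1S :: "(real^2^2) set \<Rightarrow> complex \<times> complex \<Rightarrow> complex \<times> complex \<Rightarrow> real" where
  "d1S \<Gamma> u v = (INF A\<in>\<Gamma>. d1 u (tact A v))"

text \<open>H^ss u and W^ss u in T^1 S (sets of orbits), for a lift u.\<close>
definition HssS :: "(real^2^2) set \<Rightarrow> complex \<times> complex \<Rightarrow> (complex \<times> complex) set set" where
  "HssS \<Gamma> u = orbit \<Gamma> ` Hss u"

definition WssS :: "(real^2^2) set \<Rightarrow> complex \<times> complex \<Rightarrow> (complex \<times> complex) set set" where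
  "WssS \<Gamma> u = {orbit \<Gamma> v | v. v \<in> T1H \<and>
      ((\<lambda>t. d1S \<Gamma> (gflow t u) (gflow t v)) \<longlongrightarrow> 0) at_top}"

text \<open>Length of the closed horocycle in S obtained by projecting the horocycle centered at
  the parabolic fixed point xi through z: the hyperbolic length of the horocyclic arc from z to
  A z, where A runs over the nontrivial elements of Gamma fixing xi (the minimum is attained at
  a generator of the stabiliser, giving one period of the closed curve).\<close>
definition closed_horo_length :: "(real^2^2) set \<Rightarrow> bdry \<Rightarrow> complex \<Rightarrow> real" where
  "closed_horo_length \<Gamma> \<xi> z = Inf {hlength p | p A. A \<in> \<Gamma> \<and> \<not> is_pm_id A \<and> bact A \<xi> = \<xi> \<and>
      continuous_on {0..1} p \<and> inj_on p {0..1} \<and> p ` {0..1} \<subseteq> horocycle \<xi> z \<and>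
      p 0 = z \<and> p 1 = mob A z}"

text \<open>Cusp-recurrence of the vector of T^1 S with lift u.\<close>
definition cusp_recurrent :: "(real^2^2) set \<Rightarrow> complex \<times> complex \<Rightarrow> bool" where
  "cusp_recurrent \<Gamma> u \<longleftrightarrow> \<not> parabolic_fixed \<Gamma> (vplus u) \<and>
     (\<exists>\<xi> z t. (\<forall>n::nat. parabolic_fixed \<Gamma> (\<xi> n) \<and> z n \<in> HH \<and> t n \<ge> 0 \<and>
                 (\<exists>A\<in>\<Gamma>. geod u (t n) \<in> mob A ` horocycle (\<xi> n) (z n))) \<and>
             (\<lambda>n. closed_horo_length \<Gamma> (\<xi> n) (z n)) \<longlonglongrightarrow> 0)"

end

theory Submission
  imports Defs
begin

text \<open>
  Identify unit vectors with frames \<open>F\<close> in \<open>SL(2, \<real>)\<close>, so that the geodesic flow is right multiplication by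
  a diagonal subgroup and the stable horocycles are the orbits of the upper unipotent subgroup. At a time
  when \<open>u\<close> meets a very short closed horocycle, some parabolic \<open>P \<in> \<Gamma>\<close> moves its tangent vector very little.
  A vector that follows \<open>u\<close> up to that time and \<open>P u\<close> afterwards is therefore uniformly close to \<open>u\<close> in the
  quotient for all \<open>t \<ge> 0\<close> and asymptotic there to \<open>u\<close>, but its endpoint differs from that of \<open>u\<close>, because
  the endpoint of \<open>u\<close> is not parabolic. Iterating such perturbations with summable errors, and choosing each
  one so as to avoid the next member of a given sequence of endpoints, shows that the endpoints of vectors
  in \<open>W\<^sup>s\<^sup>s u\<close> are not countable. A single stable horocycle in the quotient only accounts for one
  \<open>\<Gamma>\<close>-orbit of endpoints, and \<open>\<Gamma>\<close> is countable.
\<close>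

section \<open>Two by two matrices and the hyperbolic metric\<close>

text \<open>The perturbation is a matrix factorisation. If \<open>P\<close> displaces the point of
  \<open>U\<close> at time \<open>t\<^sub>0\<close> only slightly, then \<open>P ** U = U ** mat22 a
  (b * exp t\<^sub>0) (c * exp (- t\<^sub>0)) d\<close> with \<open>a\<close>, \<open>d\<close> near
  1 and \<open>b\<close>, \<open>c\<close> near 0. Right multiplication by an upper unipotent matrix
  cancels the possibly large upper right entry and preserves the endpoint. What is left is
  \<open>U\<close> times a lower triangular matrix near the identity, hence close to
  \<open>U\<close> until \<open>t\<^sub>0\<close>; the unipotent factor is contracted by the flow,
  hence close to \<open>P ** U\<close> from \<open>t\<^sub>0\<close> on. The endpoint moves exactly
  because \<open>c \<noteq> 0\<close>. The obstacle to iteration is that small displacements are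
  known along \<open>U\<close> only, while each further perturbation starts from an already
  perturbed frame. Therefore every stage has the form \<open>A ** U ** up s\<close>, with
  \<open>A\<close> in the group up to sign, and the next displacement is chosen small in terms of
  \<open>s\<close>. A limit of such frames may lose this form; only bounds uniform in
  \<open>t \<ge> 0\<close> survive the passage to it.\<close>

definition mat22 :: "real \<Rightarrow> real \<Rightarrow> real \<Rightarrow> real \<Rightarrow> real^2^2" where
  "mat22 a b c d = vector [vector [a, b], vector [c, d]]"

lemma mat22_nth [simp]:
  "mat22 a b c d $ 1 $ 1 = a" "mat22 a b c d $ 1 $ 2 = b"
  "mat22 a b c d $ 2 $ 1 = c" "mat22 a b c d $ 2 $ 2 = d"
  by (simp_all add: mat22_def)

lemma mat22_eqI:
  fixes A B :: "real^2^2"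
  assumes "A$1$1 = B$1$1" "A$1$2 = B$1$2" "A$2$1 = B$2$1" "A$2$2 = B$2$2"
  shows "A = B"
  using assms by (simp add: vec_eq_iff forall_2)

lemma mat22_eq_iff [simp]:
  "mat22 a b c d = mat22 a' b' c' d' \<longleftrightarrow> a = a' \<and> b = b' \<and> c = c' \<and> d = d'"
  by (metis mat22_nth)

lemma mat22_cases:
  obtains a b c d where "A = mat22 a b c d"
  by (metis mat22_eqI mat22_nth)

lemma mat22_mult [simp]:
  "mat22 a b c d ** mat22 a' b' c' d' =
   mat22 (a * a' + b * c') (a * b' + b * d') (c * a' + d * c') (c * b' + d * d')"
  by (intro mat22_eqI) (simp_all add: matrix_matrix_mult_def sum_2)

lemma mat_1_eq_mat22: "mat 1 = mat22 1 0 0 1"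
  by (intro mat22_eqI) (simp_all add: mat_def)

lemma uminus_mat22 [simp]: "- mat22 a b c d = mat22 (-a) (-b) (-c) (-d)"
  by (intro mat22_eqI) simp_all

lemma matrix_mult_minus_left: "(- A) ** B = - (A ** B)"
  for A B :: "real^2^2"
  by (cases A rule: mat22_cases, cases B rule: mat22_cases) simp

lemma matrix_mult_minus_right: "A ** (- B) = - (A ** B)"
  for A B :: "real^2^2"
  by (cases A rule: mat22_cases, cases B rule: mat22_cases) simp

lemma det_mat22 [simp]: "det (mat22 a b c d) = a * d - b * c"
  by (simp add: det_2)

lemma mob_mat22 [simp]:
  "mob (mat22 a b c d) z = (complex_of_real a * z + complex_of_real b) /
     (complex_of_real c * z + complex_of_real d)"
  by (simp add: mob_def)

text \<open>The adjugate: for determinant 1 it is the inverse, in a polynomial form with which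
  \<open>mat22\<close> can compute.\<close>

definition sinv :: "real^2^2 \<Rightarrow> real^2^2" where
  "sinv A = mat22 (A$2$2) (- A$1$2) (- A$2$1) (A$1$1)"

lemma sinv_mat22 [simp]: "sinv (mat22 a b c d) = mat22 d (-b) (-c) a"
  by (simp add: sinv_def)

lemma det_sinv [simp]: "det (sinv A) = det A"
  by (cases A rule: mat22_cases) (simp add: algebra_simps)

lemma sinv_sinv [simp]: "sinv (sinv A) = A"
  by (cases A rule: mat22_cases) simp

lemma sinv_right: "det A = 1 \<Longrightarrow> A ** sinv A = mat 1"
  by (cases A rule: mat22_cases) (simp add: mat_1_eq_mat22 algebra_simps)

lemma sinv_left: "det A = 1 \<Longrightarrow> sinv A ** A = mat 1"
  by (cases A rule: mat22_cases) (simp add: mat_1_eq_mat22 algebra_simps)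

lemma matrix_inv_eq_sinv: "det A = 1 \<Longrightarrow> matrix_inv A = sinv A"
  for A :: "real^2^2"
proof -
  assume A: "det A = 1"
  then have "\<exists>B. A ** B = mat 1 \<and> B ** A = mat 1"
    using sinv_left sinv_right by blast
  then have "A ** matrix_inv A = mat 1"
    unfolding matrix_inv_def by (rule someI2_ex) blast
  then have "sinv A ** (A ** matrix_inv A) = sinv A"
    by simp
  then show ?thesis
    using sinv_left[OF A] by (simp add: matrix_mul_assoc)
qed

lemma sinv_cancel:
  assumes "det A = 1"
  shows "sinv A ** (A ** B) = B" "A ** (sinv A ** B) = B"
  by (simp_all add: assms matrix_mul_assoc sinv_left sinv_right)

lemma HH_iff [simp]: "z \<in> HH \<longleftrightarrow> 0 < Im z"
  by (simp add: HH_def)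

lemma mob_denom_nonzero:
  assumes "det (mat22 a b c d) = 1" "0 < Im z"
  shows "complex_of_real c * z + complex_of_real d \<noteq> 0"
proof
  assume "complex_of_real c * z + complex_of_real d = 0"
  then have "c * Im z = 0" "c * Re z + d = 0"
    by (auto simp: complex_eq_iff)
  then show False using assms by auto
qed

lemma Im_mob:
  assumes "det A = 1"
  shows "Im (mob A z) = Im z / (cmod (complex_of_real (A$2$1) * z + complex_of_real (A$2$2)))\<^sup>2"
proof (cases A rule: mat22_cases)
  case (1 a b c d)
  have "a * Im z * (c * Re z + d) - (a * Re z + b) * (c * Im z) = (a * d - b * c) * Im z"
    by (simp add: algebra_simps)
  also have "a * d - b * c = 1"
    using assms 1 by simp
  finally show ?thesis
    unfolding 1 by (simp add: Im_divide')
qed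

lemma mob_in_HH: "det A = 1 \<Longrightarrow> 0 < Im z \<Longrightarrow> 0 < Im (mob A z)"
  using mob_denom_nonzero[of "A$1$1" "A$1$2" "A$2$1" "A$2$2" z]
  by (simp add: Im_mob det_2)

lemma mob_mult:
  assumes "det A = 1" "det B = 1" "0 < Im z"
  shows "mob (A ** B) z = mob A (mob B z)"
proof (cases A rule: mat22_cases, cases B rule: mat22_cases)
  fix a b c d a' b' c' d' assume AB: "A = mat22 a b c d" "B = mat22 a' b' c' d'"
  have "complex_of_real c' * z + complex_of_real d' \<noteq> 0" (is "?q \<noteq> 0")
    using mob_denom_nonzero assms AB by blast
  then show ?thesis
    by (simp add: AB divide_simps) (auto simp: algebra_simps)
qed

lemma mob_one [simp]: "mob (mat 1) z = z"
  by (simp add: mat_1_eq_mat22)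

lemma mob_sinv: "det A = 1 \<Longrightarrow> 0 < Im z \<Longrightarrow> mob (sinv A) (mob A z) = z"
  by (metis det_sinv mob_mult mob_one sinv_left)

lemma mob_sinv': "det A = 1 \<Longrightarrow> 0 < Im z \<Longrightarrow> mob A (mob (sinv A) z) = z"
  by (metis det_sinv mob_mult mob_one sinv_right)

text \<open>Cross-multiplication leaves \<open>(a * d - b * c) * (z - w)\<close> in the
  numerator.\<close>

lemma mob_diff:
  assumes "det A = 1" "0 < Im z" "0 < Im w"
  shows "mob A z - mob A w = (z - w) /
    ((complex_of_real (A$2$1) * z + complex_of_real (A$2$2)) *
     (complex_of_real (A$2$1) * w + complex_of_real (A$2$2)))"
proof (cases A rule: mat22_cases)
  case (1 a b c d)
  have nz: "complex_of_real c * z + d \<noteq> 0" "complex_of_real c * w + d \<noteq> 0"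
    using mob_denom_nonzero assms 1 by blast+
  have "complex_of_real (a * d - b * c) = 1"
    using assms 1 by simp
  then have "complex_of_real a * complex_of_real d = 1 + complex_of_real b * complex_of_real c"
    by (simp add: algebra_simps)
  moreover have "(complex_of_real a * z + b) * (complex_of_real c * w + d) - (complex_of_real a * w + b) * (complex_of_real c * z + d)
     = (complex_of_real a * complex_of_real d - complex_of_real b * complex_of_real c) * (z - w)"
    by (simp add: algebra_simps)
  ultimately have "(complex_of_real a * z + b) * (complex_of_real c * w + d) - (complex_of_real a * w + b) * (complex_of_real c * z + d)
     = z - w" by simp
  then have "(complex_of_real a * z + b) / (complex_of_real c * z + d) - (complex_of_real a * w + b) / (complex_of_real c * w + d)
     = (z - w) / ((complex_of_real c * z + d) * (complex_of_real c * w + d))"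
    by (simp only: diff_frac_eq[OF nz])
  then show ?thesis
    unfolding 1 by simp
qed

section \<open>Invariance of the hyperbolic distance and the triangle inequality\<close>

lemma cosh_hdist:
  "0 < Im z \<Longrightarrow> 0 < Im w \<Longrightarrow> cosh (hdist z w) = 1 + (cmod (z - w))\<^sup>2 / (2 * Im z * Im w)"
  unfolding hdist_def by (rule cosh_arcosh_real) simp

lemma hdist_nonneg: "0 < Im z \<Longrightarrow> 0 < Im w \<Longrightarrow> 0 \<le> hdist z w"
  unfolding hdist_def by (rule arcosh_nonneg_real) simp

lemma hdist_self [simp]: "hdist z z = 0"
  by (simp add: hdist_def)

lemma hdist_commute: "hdist z w = hdist w z"
  by (simp add: hdist_def norm_minus_commute mult.commute mult.left_commute)

text \<open>By \<open>mob_diff\<close> and \<open>Im_mob\<close>, the factors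
  \<open>c * z + d\<close> and \<open>c * w + d\<close> occur to the same power above and below in
  the ratio that defines \<open>hdist\<close>, so they cancel.\<close>

lemma hdist_mob:
  assumes "det A = 1" "0 < Im z" "0 < Im w"
  shows "hdist (mob A z) (mob A w) = hdist z w"
proof -
  let ?q = "\<lambda>z. cmod (complex_of_real (A$2$1) * z + complex_of_real (A$2$2))"
  have nz: "?q z \<noteq> 0" "?q w \<noteq> 0"
    using mob_denom_nonzero[of "A$1$1" "A$1$2" "A$2$1" "A$2$2"] assms by (auto simp: det_2)
  have "(cmod (mob A z - mob A w))\<^sup>2 / (2 * Im (mob A z) * Im (mob A w)) =
        (cmod (z - w))\<^sup>2 / (2 * Im z * Im w)"
    unfolding mob_diff[OF assms] Im_mob[OF assms(1)] norm_divide norm_mult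
    using nz by (simp add: divide_simps power_mult_distrib)
  then show ?thesis
    by (simp add: hdist_def)
qed

text \<open>At half the distance both hyperbolic functions become Euclidean distances over a common
  normalisation, so that the addition formula for \<open>sinh\<close> can be compared with a
  Euclidean inequality.\<close>

lemma sinh_half_hdist:
  assumes "0 < Im z" "0 < Im w"
  shows "sinh (hdist z w / 2) = cmod (z - w) / (2 * sqrt (Im z * Im w))"
proof (rule power2_eq_imp_eq)
  have "cosh (2 * (hdist z w / 2)) = 2 * (sinh (hdist z w / 2))\<^sup>2 + 1"
    by (simp only: cosh_double cosh_square_eq)
  then show "(sinh (hdist z w / 2))\<^sup>2 = (cmod (z - w) / (2 * sqrt (Im z * Im w)))\<^sup>2"
    using assms by (simp add: cosh_hdist power_divide power_mult_distrib)
qed (use assms hdist_nonneg in auto)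

lemma cosh_half_hdist:
  assumes "0 < Im z" "0 < Im w"
  shows "cosh (hdist z w / 2) = cmod (z - cnj w) / (2 * sqrt (Im z * Im w))"
proof (rule power2_eq_imp_eq)
  have "(cmod (z - cnj w))\<^sup>2 = (cmod (z - w))\<^sup>2 + 4 * Im z * Im w"
    unfolding cmod_power2 by (simp add: power2_eq_square algebra_simps)
  then show "(cosh (hdist z w / 2))\<^sup>2 = (cmod (z - cnj w) / (2 * sqrt (Im z * Im w)))\<^sup>2"
    using assms by (simp add: cosh_square_eq sinh_half_hdist power_divide power_mult_distrib add_divide_distrib)
qed (use assms in auto)

text \<open>In terms of \<open>sinh (d / 2)\<close> this is Ptolemy's inequality for \<open>p, q, r\<close> and the complex conjugate of \<open>q\<close>.\<close>
lemma hdist_triangle: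
  assumes "0 < Im p" "0 < Im q" "0 < Im r"
  shows "hdist p r \<le> hdist p q + hdist q r"
proof -
  have "(p - q) * (cnj q - r) - (p - cnj q) * (q - r) = (p - r) * (cnj q - q)"
    by (simp add: algebra_simps)
  then have "cmod (p - r) * cmod (cnj q - q) \<le> cmod (p - q) * cmod (cnj q - r) + cmod (p - cnj q) * cmod (q - r)"
    by (metis norm_mult norm_triangle_ineq4)
  moreover have "cmod (cnj q - q) = 2 * Im q"
    using assms by (simp add: cmod_def real_sqrt_mult)
  moreover have "cmod (cnj q - r) = cmod (q - cnj r)"
    by (metis complex_cnj_cnj complex_cnj_diff complex_mod_cnj)
  ultimately have P: "cmod (p - r) * (2 * Im q) \<le> cmod (p - q) * cmod (q - cnj r) + cmod (p - cnj q) * cmod (q - r)"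
    by simp
  have sq: "sqrt (Im p * Im q) * sqrt (Im q * Im r) = Im q * sqrt (Im p * Im r)"
    using assms by (simp add: real_sqrt_mult)
  have "sinh (hdist p r / 2) = cmod (p - r) * (2 * Im q) / (4 * (Im q * sqrt (Im p * Im r)))"
    using assms by (simp add: sinh_half_hdist)
  also have "\<dots> \<le> (cmod (p - q) * cmod (q - cnj r) + cmod (p - cnj q) * cmod (q - r)) / (4 * (Im q * sqrt (Im p * Im r)))"
    using P assms by (intro divide_right_mono) auto
  also have "\<dots> = sinh (hdist p q / 2 + hdist q r / 2)"
    using assms by (simp add: sinh_add sinh_half_hdist cosh_half_hdist sq[symmetric] add_divide_distrib)
  finally have "hdist p r / 2 \<le> hdist p q / 2 + hdist q r / 2"
    by simp
  then show ?thesis by simp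
qed

section \<open>Frames and geodesics\<close>

text \<open>Keeps \<open>complex_of_real (exp t)\<close> visibly real, so that identities for the
  real exponential can be transferred to it.\<close>

declare of_real_exp [simp del]

text \<open>The base vector is the upward unit vector at \<open>\<i>\<close>. The matrices
  \<open>F\<close> and \<open>- F\<close> give the same vector, which is why signs must be tracked
  later.\<close>

definition frame :: "real^2^2 \<Rightarrow> complex \<times> complex" where
  "frame F = tact F (\<i>, \<i>)"

text \<open>The exponents are halved so that the imaginary axis is translated at unit speed.\<close>

definition aflow :: "real \<Rightarrow> real^2^2" where
  "aflow t = mat22 (exp (t / 2)) 0 0 (exp (- (t / 2)))"

lemma det_aflow [simp]: "det (aflow t) = 1"
  by (simp add: aflow_def flip: exp_add)

lemma mob_aflow [simp]: "mob (aflow t) z = complex_of_real (exp t) * z"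
proof -
  have "exp t * exp (- (t / 2)) = exp (t / 2)"
    by (simp flip: exp_add)
  then have "complex_of_real (exp (t / 2)) = complex_of_real (exp t) * complex_of_real (exp (- (t / 2)))"
    by (metis of_real_mult)
  then show ?thesis
    by (simp add: aflow_def)
qed

lemma frame_in_T1H: "det F = 1 \<Longrightarrow> frame F \<in> T1H"
  using mob_denom_nonzero[of "F$1$1" "F$1$2" "F$2$1" "F$2$2" \<i>]
  by (simp add: frame_def T1H_def tact_def Im_mob det_2 norm_divide norm_power)

text \<open>The bottom row \<open>(c, d)\<close> of the frame is read off from \<open>w = \<i> / (c \<i> + d)\<^sup>2\<close>.\<close>
lemma T1H_imp_frame:
  assumes "v \<in> T1H"
  obtains F where "det F = 1" "v = frame F"
proof -
  obtain z w where v: "v = (z, w)" "0 < Im z" "cmod w = Im z"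
    using assms by (auto simp: T1H_def)
  define q where "q = csqrt (\<i> / w)"
  have w0: "w \<noteq> 0" using v by auto
  have q2: "q\<^sup>2 = \<i> / w" by (simp add: q_def)
  then have q0: "q \<noteq> 0" using w0 by auto
  have "(cmod q)\<^sup>2 = 1 / Im z"
    using q2 v by (simp add: norm_divide flip: norm_power)
  then have nq: "(Re q)\<^sup>2 + (Im q)\<^sup>2 = 1 / Im z"
    by (simp add: cmod_power2)
  define F where "F = mat22 (Im (z * q)) (Re (z * q)) (Im q) (Re q)"
  have "det F = Im z * ((Re q)\<^sup>2 + (Im q)\<^sup>2)"
    by (simp add: F_def algebra_simps power2_eq_square)
  then have "det F = 1"
    using v nq by simp
  have qq: "complex_of_real (Im q) * \<i> + complex_of_real (Re q) = q" for q
    by (metis add.commute complex_eq mult.commute)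
  have "v = frame F"
    using q0 w0 q2 by (simp add: frame_def tact_def F_def v qq del: times_complex.sel)
  with \<open>det F = 1\<close> show ?thesis by (rule that)
qed

text \<open>This is the chain rule: the denominator of \<open>A ** B\<close> at \<open>z\<close> is
  that of \<open>B\<close> at \<open>z\<close> times that of \<open>A\<close> at
  \<open>mob B z\<close>.\<close>

lemma tact_mult:
  assumes "det A = 1" "det B = 1" "0 < Im (fst v)"
  shows "tact (A ** B) v = tact A (tact B v)"
proof (cases A rule: mat22_cases, cases B rule: mat22_cases, cases v)
  fix a b c d a' b' c' d' z w assume AB: "A = mat22 a b c d" "B = mat22 a' b' c' d'" and v: "v = (z, w)"
  have q: "complex_of_real c' * z + complex_of_real d' \<noteq> 0" (is "?q \<noteq> 0")
    using mob_denom_nonzero assms AB v by simp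
  have "complex_of_real (c * a' + d * c') * z + complex_of_real (c * b' + d * d') =
    ?q * (complex_of_real c * mob B z + complex_of_real d)"
    using q by (simp add: AB field_simps)
  then show ?thesis
    using assms mob_mult[of A B z] by (simp add: tact_def AB v power_mult_distrib)
qed

lemma tact_frame: "det A = 1 \<Longrightarrow> det F = 1 \<Longrightarrow> tact A (frame F) = frame (A ** F)"
  by (simp add: frame_def tact_mult)

lemma frame_uminus [simp]: "frame (- F) = frame F"
proof (cases F rule: mat22_cases)
  case (1 a b c d)
  have "(- complex_of_real a * \<i> - b) / (- complex_of_real c * \<i> - d) =
    (- (complex_of_real a * \<i> + b)) / (- (complex_of_real c * \<i> + d))"
    by simp
  also have "\<dots> = (complex_of_real a * \<i> + b) / (complex_of_real c * \<i> + d)"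
    by (rule minus_divide_divide)
  finally show ?thesis
    using power2_minus[of "complex_of_real c * \<i> + d"] by (simp add: frame_def tact_def 1)
qed

lemma mob_has_field_derivative:
  assumes "det A = 1" "0 < Im z"
  shows "(mob A has_field_derivative 1 / (complex_of_real (A$2$1) * z + complex_of_real (A$2$2))\<^sup>2) (at z)"
proof (cases A rule: mat22_cases)
  case (1 a b c d)
  have q: "complex_of_real c * z + d \<noteq> 0"
    using mob_denom_nonzero assms 1 by blast
  have "complex_of_real (a * d - b * c) = 1"
    using assms 1 by simp
  then have *: "complex_of_real a * (complex_of_real c * z + d) - (complex_of_real a * z + b) * complex_of_real c = 1"
    by (simp add: algebra_simps)
  have "((\<lambda>z. (complex_of_real a * z + b) / (complex_of_real c * z + d)) has_field_derivative
     (complex_of_real a * (complex_of_real c * z + d) - (complex_of_real a * z + b) * complex_of_real c)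
       / ((complex_of_real c * z + d) * (complex_of_real c * z + d))) (at z)"
    by (rule DERIV_quotient[THEN DERIV_cong] derivative_eq_intros refl q | simp)+
  then show ?thesis
    unfolding * 1 by (simp add: power2_eq_square mob_mat22[abs_def])
qed

lemma mob_geodesic_derivative:
  assumes "det F = 1"
  shows "((\<lambda>t. mob F (complex_of_real (exp t) * \<i>)) has_vector_derivative snd (frame (F ** aflow t))) (at t)"
proof -
  have 1: "((\<lambda>t. complex_of_real (exp t) * \<i>) has_vector_derivative complex_of_real (exp t) * \<i>) (at t)"
    by (auto intro!: derivative_eq_intros simp: has_vector_derivative_def scaleR_conv_of_real
        intro: has_derivative_eq_rhs)
  have "((mob F \<circ> (\<lambda>t. complex_of_real (exp t) * \<i>)) has_vector_derivative (complex_of_real (exp t) * \<i>) *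
     (1 / (complex_of_real (F$2$1) * (complex_of_real (exp t) * \<i>) + complex_of_real (F$2$2))\<^sup>2)) (at t)"
    by (rule field_vector_diff_chain_at[OF 1]) (rule mob_has_field_derivative[OF assms], simp)
  moreover have "snd (frame (F ** aflow t)) = (complex_of_real (exp t) * \<i>) *
     (1 / (complex_of_real (F$2$1) * (complex_of_real (exp t) * \<i>) + complex_of_real (F$2$2))\<^sup>2)"
  proof (cases F rule: mat22_cases)
    case (1 a b c d)
    have "exp t * exp (- (t / 2)) = exp (t / 2)"
      by (simp flip: exp_add)
    then have e1: "complex_of_real (exp (t / 2)) = complex_of_real (exp t) * complex_of_real (exp (- (t / 2)))"
      by (metis of_real_mult)
    have "exp t * (exp (- (t / 2)))\<^sup>2 = 1"
      by (simp add: power2_eq_square flip: exp_add)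
    then have e2: "complex_of_real (exp t) * (complex_of_real (exp (- (t / 2))))\<^sup>2 = 1"
      by (metis of_real_mult of_real_power of_real_1)
    define E where "E = complex_of_real (exp (- (t / 2)))"
    define T where "T = complex_of_real (exp t)"
    have ET: "T * E\<^sup>2 = 1" "E \<noteq> 0"
      using e2 by (auto simp: E_def T_def)
    have "snd (frame (F ** aflow t)) = \<i> / (complex_of_real c * (T * E) * \<i> + complex_of_real d * E)\<^sup>2"
      by (simp add: 1 aflow_def frame_def tact_def e1 flip: E_def T_def)
    also have "complex_of_real c * (T * E) * \<i> + complex_of_real d * E = E * (complex_of_real c * (T * \<i>) + d)"
      by (simp add: algebra_simps)
    also have "\<i> / \<dots>\<^sup>2 = (T * E\<^sup>2) * \<i> / \<dots>\<^sup>2"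
      using ET by simp
    also have "\<dots> = (T * \<i>) * (1 / (complex_of_real c * (T * \<i>) + d)\<^sup>2)"
      using ET(2) by (simp add: power_mult_distrib)
    finally show ?thesis by (simp add: 1 T_def)
  qed
  ultimately show ?thesis by (simp add: o_def)
qed

lemma hdist_imaginary_axis: "hdist (complex_of_real (exp s) * \<i>) (complex_of_real (exp t) * \<i>) = \<bar>s - t\<bar>"
proof -
  have "1 + (exp s - exp t)\<^sup>2 / (2 * exp s * exp t) = cosh (s - t)"
    by (simp add: cosh_def field_simps power2_eq_square exp_minus exp_diff)
  moreover have "(cmod (complex_of_real (exp s) * \<i> - complex_of_real (exp t) * \<i>))\<^sup>2 = (exp s - exp t)\<^sup>2"
    by (simp add: norm_mult flip: left_diff_distrib of_real_diff of_real_exp)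
  ultimately have "hdist (complex_of_real (exp s) * \<i>) (complex_of_real (exp t) * \<i>) = arcosh (cosh (s - t))"
    by (simp add: hdist_def)
  also have "cosh (s - t) = cosh \<bar>s - t\<bar>"
    by simp
  finally show ?thesis
    by (simp only: arcosh_cosh_real abs_ge_zero)
qed

text \<open>The value and the derivative at \<open>s = 0\<close> of \<open>cosh (s - t) = cosh (hdist (c s) (c t))\<close> determine \<open>c t\<close>.\<close>
lemma geodesic_unique:
  assumes c0: "c 0 = \<i>" and c': "(c has_vector_derivative \<i>) (at 0)"
    and iso: "\<And>s t. c s \<in> HH \<and> hdist (c s) (c t) = \<bar>s - t\<bar>"
  shows "c t = complex_of_real (exp t) * \<i>"
proof -
  define a b where "a = Re (c t)" and "b = Im (c t)"
  have b: "0 < b" using iso[of t t] by (simp add: b_def)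
  have eq: "2 * b * Im (c s) * (cosh (s - t) - 1) = (Re (c s) - a)\<^sup>2 + (Im (c s) - b)\<^sup>2" for s
  proof -
    have p: "0 < Im (c s)" "0 < Im (c t)"
      using iso[of s s] iso[of t t] by auto
    have "cosh (s - t) = cosh (hdist (c s) (c t))"
      using iso[of s t] by simp
    also have "\<dots> = 1 + ((Re (c s) - a)\<^sup>2 + (Im (c s) - b)\<^sup>2) / (2 * Im (c s) * b)"
      using cosh_hdist[OF p] by (simp add: cmod_power2 a_def b_def)
    finally show ?thesis
      using p b by (simp add: field_simps)
  qed
  have X: "((\<lambda>s. Re (c s)) has_real_derivative 0) (at 0)"
    using bounded_linear.has_vector_derivative[OF bounded_linear_Re c']
    by (simp add: has_real_derivative_iff_has_vector_derivative)
  have Y: "((\<lambda>s. Im (c s)) has_real_derivative 1) (at 0)"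
    using bounded_linear.has_vector_derivative[OF bounded_linear_Im c']
    by (simp add: has_real_derivative_iff_has_vector_derivative)
  have L: "((\<lambda>s. 2 * b * Im (c s) * (cosh (s - t) - 1)) has_real_derivative
     2 * b * (cosh t - 1) - 2 * b * sinh t) (at 0)"
    by (rule derivative_eq_intros X Y refl)+ (simp add: c0 algebra_simps)
  have R: "((\<lambda>s. (Re (c s) - a)\<^sup>2 + (Im (c s) - b)\<^sup>2) has_real_derivative 2 * (1 - b)) (at 0)"
    by (rule derivative_eq_intros X Y refl)+ (simp add: c0)
  have "2 * b * (cosh t - 1) - 2 * b * sinh t = 2 * (1 - b)"
    using DERIV_unique[OF L[unfolded eq] R] .
  then have "b * (cosh t - sinh t) = 1"
    by (simp add: algebra_simps)
  then have bt: "b = exp t"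
    by (simp add: cosh_minus_sinh exp_minus field_simps)
  have "2 * b * (cosh t - 1) = a\<^sup>2 + (1 - b)\<^sup>2"
    using eq[of 0] by (simp add: c0)
  moreover have "2 * b * cosh t = b\<^sup>2 + 1"
    by (simp add: bt cosh_def exp_minus field_simps power2_eq_square)
  ultimately have "a = 0"
    by (simp add: algebra_simps power2_eq_square)
  then show ?thesis
    using bt by (simp add: complex_eq_iff a_def b_def)
qed

text \<open>As \<open>geod\<close> is a definite description, competing curves must be excluded. The
  image of such a curve under \<open>sinv F\<close> is an isometric curve through
  \<open>\<i>\<close> with velocity \<open>\<i>\<close>, to which \<open>geodesic_unique\<close>
  applies.\<close>

lemma geod_frame:
  assumes F: "det F = 1"
  shows "geod (frame F) = (\<lambda>t. mob F (complex_of_real (exp t) * \<i>))"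
  unfolding geod_def
proof (rule the_equality)
  show "mob F (complex_of_real (exp 0) * \<i>) = fst (frame F) \<and>
    ((\<lambda>t. mob F (complex_of_real (exp t) * \<i>)) has_vector_derivative snd (frame F)) (at 0) \<and>
    (\<forall>s t. mob F (complex_of_real (exp s) * \<i>) \<in> HH \<and> hdist (mob F (complex_of_real (exp s) * \<i>)) (mob F (complex_of_real (exp t) * \<i>)) = \<bar>s - t\<bar>)"
  proof (intro conjI allI)
    have "F ** aflow 0 = F"
      by (simp add: aflow_def flip: mat_1_eq_mat22)
    then show "((\<lambda>t. mob F (complex_of_real (exp t) * \<i>)) has_vector_derivative snd (frame F)) (at 0)"
      using mob_geodesic_derivative[OF F, of 0] by simp
  next
    fix s t :: real
    show "mob F (complex_of_real (exp s) * \<i>) \<in> HH"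
      using mob_in_HH[OF F] by simp
    show "hdist (mob F (complex_of_real (exp s) * \<i>)) (mob F (complex_of_real (exp t) * \<i>)) = \<bar>s - t\<bar>"
      by (simp only: hdist_imaginary_axis[symmetric]) (rule hdist_mob[OF F], simp_all)
  qed (simp add: frame_def tact_def)
next
  fix c assume c: "c 0 = fst (frame F) \<and> (c has_vector_derivative snd (frame F)) (at 0) \<and>
       (\<forall>s t. c s \<in> HH \<and> hdist (c s) (c t) = \<bar>s - t\<bar>)"
  have F': "det (sinv F) = 1" using F by simp
  have c0: "c 0 = mob F \<i>" using c by (simp add: frame_def tact_def)
  have cH: "0 < Im (c s)" for s using c HH_iff by blast
  have "frame (mat 1) = tact (sinv F) (frame F)"
    using F by (simp add: tact_frame sinv_left)
  then have d: "\<i> = snd (frame F) / (complex_of_real (sinv F$2$1) * c 0 + complex_of_real (sinv F$2$2))\<^sup>2"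
    using c by (simp add: frame_def tact_def mat_1_eq_mat22)
  have "((mob (sinv F) \<circ> c) has_vector_derivative snd (frame F) *
     (1 / (complex_of_real (sinv F$2$1) * c 0 + complex_of_real (sinv F$2$2))\<^sup>2)) (at 0)"
    using c by (intro field_vector_diff_chain_at mob_has_field_derivative F' cH) auto
  then have der: "((\<lambda>t. mob (sinv F) (c t)) has_vector_derivative \<i>) (at 0)"
    using d by (simp add: o_def)
  have "mob (sinv F) (c t) = complex_of_real (exp t) * \<i>" for t
  proof (rule geodesic_unique[OF _ der])
    show "mob (sinv F) (c 0) = \<i>"
      using F by (simp add: c0 mob_sinv)
    show "mob (sinv F) (c s) \<in> HH \<and> hdist (mob (sinv F) (c s)) (mob (sinv F) (c t)) = \<bar>s - t\<bar>" for s t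
      using c cH mob_in_HH[OF F'] hdist_mob[OF F'] by auto
  qed
  then show "c = (\<lambda>t. mob F (complex_of_real (exp t) * \<i>))"
    using mob_sinv'[OF F cH] by (metis (no_types, lifting) ext)
qed

lemma gflow_frame:
  assumes "det F = 1"
  shows "gflow t (frame F) = frame (F ** aflow t)"
proof -
  have "vector_derivative (geod (frame F)) (at t) = snd (frame (F ** aflow t))"
    unfolding geod_frame[OF assms]
    by (rule vector_derivative_at) (rule mob_geodesic_derivative[OF assms])
  moreover have "geod (frame F) t = fst (frame (F ** aflow t))"
    unfolding geod_frame[OF assms] using mob_mult[OF assms, of "aflow t" \<i>]
    by (simp add: frame_def tact_def)
  ultimately show ?thesis
    by (simp add: gflow_def prod_eq_iff)
qed

section \<open>Endpoints of geodesics on the boundary\<close>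

lemma tendsto_exp_at_top_inverse: "((\<lambda>t. inverse (complex_of_real (exp t))) \<longlongrightarrow> 0) at_top"
proof -
  have "((\<lambda>t::real. inverse (exp t)) \<longlongrightarrow> 0) at_top"
    by (rule tendsto_inverse_0_at_top) (rule exp_at_top)
  from tendsto_of_real[OF this, where 'a=complex] show ?thesis
    by (simp add: of_real_inverse)
qed

lemma geod_tends_bdry:
  assumes "det F = 1"
  shows "tends_bdry (geod (frame F)) (bact F None)"
proof (cases F rule: mat22_cases)
  case (1 a b c d)
  have ad: "a * d - b * c = 1" using assms 1 by simp
  show ?thesis
  proof (cases "c = 0")
    case True
    then have d: "d \<noteq> 0" "a \<noteq> 0" using ad by auto
    \<comment> \<open>The endpoint is infinity here, and the imaginary part of the geodesic bounds
      its modulus from below.\<close>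
    have "filterlim (\<lambda>t. \<bar>a / d\<bar> * exp t) at_top at_top"
      by (rule filterlim_tendsto_pos_mult_at_top[OF tendsto_const _ exp_at_top]) (use d in simp)
    moreover have "\<bar>a / d\<bar> * exp t \<le> cmod (mob F (complex_of_real (exp t) * \<i>))" for t
    proof -
      have "\<bar>a / d\<bar> * exp t = \<bar>Im (mob F (complex_of_real (exp t) * \<i>))\<bar>"
        using d True by (simp add: 1 abs_mult Im_divide' power2_eq_square)
      then show ?thesis using abs_Im_le_cmod by metis
    qed
    ultimately show ?thesis
      unfolding geod_frame[OF assms] tends_bdry_def bact_def using True 1
      by (auto intro: filterlim_at_top_mono simp del: mob_mat22)
  next
    case False
    \<comment> \<open>Numerator and denominator are divided by \<open>exp t\<close>; the new
      denominator tends to \<open>c * \<i>\<close>, which is nonzero.\<close>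
    have "((\<lambda>t. (complex_of_real a * \<i> + b * inverse (complex_of_real (exp t))) /
      (complex_of_real c * \<i> + d * inverse (complex_of_real (exp t)))) \<longlongrightarrow>
      (complex_of_real a * \<i> + complex_of_real b * 0) / (complex_of_real c * \<i> + complex_of_real d * 0)) at_top"
      by (intro tendsto_intros tendsto_exp_at_top_inverse) (use False in simp)
    moreover have "(complex_of_real a * \<i> + b * inverse (complex_of_real (exp t))) /
      (complex_of_real c * \<i> + d * inverse (complex_of_real (exp t))) = mob F (complex_of_real (exp t) * \<i>)" (is "?n / ?d = _") for t
    proof -
      have "mob F (complex_of_real (exp t) * \<i>) = (complex_of_real (exp t) * ?n) / (complex_of_real (exp t) * ?d)"
        by (simp add: 1 algebra_simps)
      then show ?thesis by simp
    qed
    ultimately show ?thesis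
      unfolding geod_frame[OF assms] tends_bdry_def bact_def using False 1 by simp
  qed
qed

text \<open>A curve with a finite limit is bounded, so it cannot also tend to infinity. This is what
  lets the description in \<open>vplus\<close> be evaluated.\<close>

lemma tends_bdry_unique:
  assumes "tends_bdry c \<xi>" "tends_bdry c \<eta>"
  shows "\<xi> = \<eta>"
proof -
  have no: False if "(c \<longlongrightarrow> x) at_top" "filterlim (\<lambda>t. cmod (c t)) at_top at_top" for x
    using that tendsto_norm[OF that(1)] not_tendsto_and_filterlim_at_infinity[of at_top "\<lambda>t. cmod (c t)"]
      filterlim_at_top_imp_at_infinity by (metis trivial_limit_at_top_linorder)
  show ?thesis
    using assms no tendsto_unique[of at_top c]
    by (fastforce simp: tends_bdry_def split: option.splits)
qed

lemma vplus_frame: "det F = 1 \<Longrightarrow> vplus (frame F) = bact F None"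
  unfolding vplus_def using geod_tends_bdry tends_bdry_unique by blast

lemma bact_mult:
  assumes "det A = 1" "det B = 1"
  shows "bact A (bact B None) = bact (A ** B) None"
proof (cases A rule: mat22_cases, cases B rule: mat22_cases)
  fix a b c d a' b' c' d' assume AB: "A = mat22 a b c d" "B = mat22 a' b' c' d'"
  have "a' * d' - b' * c' = 1" using assms AB by simp
  then show ?thesis
    by (auto simp: bact_def AB divide_simps split: if_splits)
qed

text \<open>In homogeneous coordinates the endpoint is the first column, so equality of endpoints is
  proportionality of first columns: one polynomial equation, with no separate case for
  infinity.\<close>

lemma bact_eq_iff:
  assumes "det F = 1" "det G = 1"
  shows "bact F None = bact G None \<longleftrightarrow> F$1$1 * G$2$1 = G$1$1 * F$2$1"
  using assms by (auto simp: bact_def det_2 field_simps)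

section \<open>Busemann functions and horocycles\<close>

text \<open>The Poisson kernel at \<open>\<xi>\<close>, up to normalisation. Its level sets are the
  horocycles centred at \<open>\<xi>\<close>.\<close>

definition height :: "bdry \<Rightarrow> complex \<Rightarrow> real" where
  "height \<xi> z = (case \<xi> of None \<Rightarrow> Im z | Some x \<Rightarrow> Im z / (cmod (z - complex_of_real x))\<^sup>2)"

lemma real_point_neq: "0 < Im z \<Longrightarrow> z \<noteq> complex_of_real x"
  by auto

lemma height_pos: "0 < Im z \<Longrightarrow> 0 < height \<xi> z"
  using real_point_neq[of z] by (auto simp: height_def split: option.split)

text \<open>After a change of coordinates that moves infinity to \<open>\<xi>\<close>, the height is
  a constant multiple of \<open>Im\<close>. Horocycles thereby become horizontal lines.\<close>

lemma height_mob:
  assumes "det K = 1" "0 < Im z"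
  shows "height (bact K None) (mob K z) = Im z * (if K$2$1 = 0 then (K$1$1)\<^sup>2 else (K$2$1)\<^sup>2)"
proof (cases K rule: mat22_cases)
  case (1 a b c d)
  have ad: "a * d - b * c = 1" using assms 1 by simp
  have q: "complex_of_real c * z + d \<noteq> 0" (is "?q \<noteq> 0")
    using mob_denom_nonzero assms 1 by blast
  show ?thesis
  proof (cases "c = 0")
    case True
    then have "a * d = 1" using ad by simp
    then have "1 / d = a" by (auto simp: divide_eq_eq)
    have "Im (mob K z) = Im z * (1 / d)\<^sup>2"
      using Im_mob[OF assms(1), of z] True by (simp add: 1 power_divide)
    then show ?thesis
      using True \<open>1 / d = a\<close> by (simp add: height_def bact_def 1 del: mob_mat22)
  next
    case False
    have "(complex_of_real a * z + b) * complex_of_real c - complex_of_real a * ?q = - complex_of_real (a * d - b * c)"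
      by (simp add: algebra_simps)
    then have "(complex_of_real a * z + b) / ?q - complex_of_real (a / c) = - 1 / (?q * complex_of_real c)"
      using False q by (simp only: of_real_divide, subst diff_frac_eq) (simp_all add: ad)
    then have "cmod (mob K z - complex_of_real (a / c)) = 1 / (cmod ?q * \<bar>c\<bar>)"
      by (simp add: 1 norm_divide norm_mult del: of_real_divide)
    moreover have "Im (mob K z) = Im z / (cmod ?q)\<^sup>2"
      using Im_mob[OF assms(1), of z] by (simp add: 1)
    ultimately show ?thesis
      using False q by (simp add: height_def bact_def 1 power_divide power_mult_distrib del: mob_mat22 of_real_divide)
  qed
qed

lemma bdry_frame:
  obtains K where "det K = 1" "bact K None = \<xi>"
proof (cases \<xi>)
  case None
  then show ?thesis
    using that[of "mat 1"] by (simp add: bact_def mat_1_eq_mat22)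
next
  case (Some x)
  then show ?thesis
    using that[of "mat22 x (-1) 1 0"] by (simp add: bact_def)
qed

text \<open>Since \<open>arcosh (1 + s)\<close> is the logarithm of
  \<open>1 + s + sqrt ((1 + s)\<^sup>2 - 1)\<close>, it grows like \<open>ln (2 * s)\<close>.
  Differences of large distances thus turn into logarithms of Euclidean ratios.\<close>

lemma arcosh_minus_ln_tendsto: "((\<lambda>s::real. arcosh (1 + s) - ln s) \<longlongrightarrow> ln 2) at_top"
proof -
  have i: "((\<lambda>s::real. inverse s) \<longlongrightarrow> 0) at_top"
    by (rule tendsto_inverse_0_at_top) (rule filterlim_ident)
  have "((\<lambda>s::real. ln (inverse s + 1 + sqrt (1 + 2 * inverse s))) \<longlongrightarrow> ln (0 + 1 + sqrt (1 + 2 * 0))) at_top"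
    by (intro tendsto_intros i) simp
  moreover have "\<forall>\<^sub>F s::real in at_top. ln (inverse s + 1 + sqrt (1 + 2 * inverse s)) = arcosh (1 + s) - ln s"
    using eventually_gt_at_top[of 0]
  proof eventually_elim
    case (elim s)
    have "s * sqrt (1 + 2 * inverse s) = sqrt (s\<^sup>2 * (1 + 2 * inverse s))"
      using elim by (simp add: real_sqrt_mult)
    also have "s\<^sup>2 * (1 + 2 * inverse s) = (1 + s)\<^sup>2 - 1"
      using elim by (simp add: power2_eq_square field_simps)
    finally have "s * (inverse s + 1 + sqrt (1 + 2 * inverse s)) = 1 + s + sqrt ((1 + s)\<^sup>2 - 1)"
      using elim by (simp add: distrib_left)
    then have "arcosh (1 + s) = ln (s * (inverse s + 1 + sqrt (1 + 2 * inverse s)))"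
      using elim by (simp add: arcosh_real_def)
    also have "\<dots> = ln s + ln (inverse s + 1 + sqrt (1 + 2 * inverse s))"
      using elim by (intro ln_mult_pos add_pos_nonneg) auto
    finally show ?case by simp
  qed
  ultimately show ?thesis
    by (simp add: filterlim_cong[OF refl refl])
qed

text \<open>The expression is the quotient of the two values of \<open>cosh d - 1\<close>, from
  which \<open>Im (c t)\<close> has cancelled. At infinity
  \<open>(x - c t) / (y - c t) = 1 + (x - y) / (y - c t)\<close> tends to 1; at a real point
  continuity suffices.\<close>

lemma distance_ratio_tendsto:
  assumes x: "0 < Im x" and y: "0 < Im y" and c: "tends_bdry c \<xi>"
  shows "((\<lambda>t. (cmod (x - c t))\<^sup>2 / (cmod (y - c t))\<^sup>2 * (Im y / Im x)) \<longlongrightarrow> height \<xi> y / height \<xi> x) at_top"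
proof (cases \<xi>)
  case None
  have inf: "filterlim (\<lambda>t. cmod (c t)) at_top at_top"
    using c None by (simp add: tends_bdry_def)
  have "filterlim (\<lambda>t. - cmod y + cmod (c t)) at_top at_top"
    by (rule filterlim_tendsto_add_at_top[OF tendsto_const inf])
  then have infy: "filterlim (\<lambda>t. cmod (y - c t)) at_top at_top"
    by (rule filterlim_at_top_mono) (auto intro!: always_eventually, metis norm_minus_commute norm_triangle_ineq2 add.commute uminus_add_conv_diff)
  have "((\<lambda>t. (x - y) / (y - c t)) \<longlongrightarrow> 0) at_top"
    by (rule tendsto_divide_0[OF tendsto_const]) (rule filterlim_norm_at_top_imp_at_infinity[OF infy])
  then have "((\<lambda>t. (cmod (1 + (x - y) / (y - c t)))\<^sup>2 * (Im y / Im x)) \<longlongrightarrow> (cmod (1 + 0))\<^sup>2 * (Im y / Im x)) at_top"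
    by (intro tendsto_intros)
  moreover have "\<forall>\<^sub>F t in at_top. (cmod (1 + (x - y) / (y - c t)))\<^sup>2 * (Im y / Im x) = (cmod (x - c t))\<^sup>2 / (cmod (y - c t))\<^sup>2 * (Im y / Im x)"
    using filterlim_at_top_dense[THEN iffD1, OF infy, rule_format, of 0]
  proof eventually_elim
    case (elim t)
    then have "1 + (x - y) / (y - c t) = (x - c t) / (y - c t)"
      by (simp add: field_simps)
    then show ?case by (simp add: norm_divide power_divide)
  qed
  ultimately show ?thesis
    by (simp add: height_def None filterlim_cong[OF refl refl])
next
  case (Some r)
  have lim: "(c \<longlongrightarrow> complex_of_real r) at_top"
    using c Some by (simp add: tends_bdry_def)
  have "((\<lambda>t. (cmod (x - c t))\<^sup>2 / (cmod (y - c t))\<^sup>2 * (Im y / Im x)) \<longlongrightarrow>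
     (cmod (x - complex_of_real r))\<^sup>2 / (cmod (y - complex_of_real r))\<^sup>2 * (Im y / Im x)) at_top"
    by (intro tendsto_intros lim) (use real_point_neq[OF y, of r] in simp)
  then show ?thesis
    by (simp add: height_def Some mult.commute)
qed

text \<open>With \<open>S = cosh d - 1\<close> each distance is \<open>ln S + ln 2\<close> up to a
  null function, and \<open>ln 2\<close> drops out of the difference. That \<open>S\<close> diverges
  follows from the triangle inequality, as the ray moves away from its own origin at unit
  speed.\<close>

lemma busemann_limit:
  assumes x: "0 < Im x" and y: "0 < Im y" and ray: "georay c" and c: "tends_bdry c \<xi>"
  shows "((\<lambda>t. hdist x (c t) - hdist y (c t)) \<longlongrightarrow> ln (height \<xi> y / height \<xi> x)) at_top"
proof -
  have cH: "0 < Im (c t)" if "0 \<le> t" for t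
    using ray that by (auto simp: georay_def)
  define S where "S z t = cosh (hdist z (c t)) - 1" for z t
  have inf: "filterlim (S z) at_top at_top" if z: "0 < Im z" for z
  proof -
    have "filterlim (\<lambda>t. - hdist z (c 0) + t) at_top at_top"
      by (rule filterlim_tendsto_add_at_top[OF tendsto_const filterlim_ident])
    moreover have "\<forall>\<^sub>F t in at_top. - hdist z (c 0) + t \<le> hdist z (c t)"
      using eventually_ge_at_top[of 0]
    proof eventually_elim
      case (elim t)
      have "hdist (c 0) (c t) = t"
        using ray elim by (auto simp: georay_def)
      then show ?case
        using hdist_triangle[of "c 0" z "c t"] hdist_commute[of "c 0" z] cH[of 0] cH[of t] z elim by simp
    qed
    ultimately have "filterlim (\<lambda>t. hdist z (c t)) at_top at_top"
      by (rule filterlim_at_top_mono)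
    then have "filterlim (\<lambda>t. -1 + cosh (hdist z (c t))) at_top at_top"
      by (intro filterlim_tendsto_add_at_top[OF tendsto_const] filterlim_compose[OF cosh_real_at_top])
    then show ?thesis by (simp add: S_def[abs_def])
  qed
  have L: "((\<lambda>t. hdist z (c t) - ln (S z t)) \<longlongrightarrow> ln 2) at_top" if z: "0 < Im z" for z
  proof (rule Lim_transform_eventually[OF filterlim_compose[OF arcosh_minus_ln_tendsto inf[OF z]]])
    show "\<forall>\<^sub>F t in at_top. arcosh (1 + S z t) - ln (S z t) = hdist z (c t) - ln (S z t)"
      using eventually_ge_at_top[of 0]
      by eventually_elim (use z cH in \<open>auto simp: S_def arcosh_cosh_real hdist_nonneg\<close>)
  qed
  have R: "((\<lambda>t. ln ((cmod (x - c t))\<^sup>2 / (cmod (y - c t))\<^sup>2 * (Im y / Im x))) \<longlongrightarrow> ln (height \<xi> y / height \<xi> x)) at_top"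
    using height_pos[OF x, of \<xi>] height_pos[OF y, of \<xi>]
    by (intro tendsto_ln distance_ratio_tendsto[OF x y c]) auto
  have "((\<lambda>t. (hdist x (c t) - ln (S x t)) - (hdist y (c t) - ln (S y t)) +
     ln ((cmod (x - c t))\<^sup>2 / (cmod (y - c t))\<^sup>2 * (Im y / Im x))) \<longlongrightarrow> ln 2 - ln 2 + ln (height \<xi> y / height \<xi> x)) at_top"
    by (intro tendsto_intros L x y R)
  moreover have "\<forall>\<^sub>F t in at_top. (hdist x (c t) - ln (S x t)) - (hdist y (c t) - ln (S y t)) +
     ln ((cmod (x - c t))\<^sup>2 / (cmod (y - c t))\<^sup>2 * (Im y / Im x)) = hdist x (c t) - hdist y (c t)"
    using eventually_ge_at_top[of 0] filterlim_at_top_dense[THEN iffD1, OF inf[OF x], rule_format, of 0]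
      filterlim_at_top_dense[THEN iffD1, OF inf[OF y], rule_format, of 0]
  proof eventually_elim
    case (elim t)
    have Sx: "S x t = (cmod (x - c t))\<^sup>2 / (2 * Im x * Im (c t))" and Sy: "S y t = (cmod (y - c t))\<^sup>2 / (2 * Im y * Im (c t))"
      using x y cH[OF elim(1)] by (simp_all add: S_def cosh_hdist)
    have "(cmod (x - c t))\<^sup>2 / (cmod (y - c t))\<^sup>2 * (Im y / Im x) = S x t / S y t"
      using x y cH[OF elim(1)] by (simp add: Sx Sy)
    then show ?case
      using elim by (simp add: ln_div)
  qed
  ultimately show ?thesis
    using Lim_transform_eventually by fastforce
qed

lemma georay_geod: "det F = 1 \<Longrightarrow> georay (geod (frame F))"
  unfolding georay_def geod_frame
  by (simp add: mob_in_HH hdist_mob hdist_imaginary_axis)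

lemma busemann_eq:
  assumes "0 < Im x" "0 < Im y"
  shows "busemann \<xi> x y = ln (height \<xi> y / height \<xi> x)"
  unfolding busemann_def
proof (rule the_equality)
  show "\<forall>c. georay c \<and> tends_bdry c \<xi> \<longrightarrow>
     ((\<lambda>t. hdist x (c t) - hdist y (c t)) \<longlongrightarrow> ln (height \<xi> y / height \<xi> x)) at_top"
    using busemann_limit[OF assms] by blast
next
  fix L assume L: "\<forall>c. georay c \<and> tends_bdry c \<xi> \<longrightarrow>
     ((\<lambda>t. hdist x (c t) - hdist y (c t)) \<longlongrightarrow> L) at_top"
  \<comment> \<open>A ray towards \<open>\<xi>\<close> must be exhibited, since otherwise every
    \<open>L\<close> would satisfy the condition vacuously.\<close>
  obtain K where K: "det K = 1" "bact K None = \<xi>"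
    by (rule bdry_frame)
  have ray: "georay (geod (frame K))" "tends_bdry (geod (frame K)) \<xi>"
    using georay_geod geod_tends_bdry K by auto
  show "L = ln (height \<xi> y / height \<xi> x)"
    using L ray busemann_limit[OF assms ray] tendsto_unique trivial_limit_at_top_linorder by metis
qed

lemma busemann_eq_0_iff:
  assumes "0 < Im x" "0 < Im y"
  shows "busemann \<xi> x y = 0 \<longleftrightarrow> height \<xi> x = height \<xi> y"
  using height_pos[OF assms(1), of \<xi>] height_pos[OF assms(2), of \<xi>]
  by (auto simp: busemann_eq[OF assms] ln_div)

section \<open>Stable horocycles as orbits of the upper unipotent group\<close>

definition up :: "real \<Rightarrow> real^2^2" where
  "up s = mat22 1 s 0 1"

lemma det_up [simp]: "det (up s) = 1"
  by (simp add: up_def)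

lemma det_mult_1: "det A = 1 \<Longrightarrow> det B = 1 \<Longrightarrow> det (A ** B) = 1"
  for A B :: "real^2^2"
  by (simp add: det_mul)

lemma same_first_column:
  assumes "det F = 1" "det G = 1" "F$1$1 = G$1$1" "F$2$1 = G$2$1"
  shows "\<exists>s. G = F ** up s"
proof (cases F rule: mat22_cases, cases G rule: mat22_cases)
  fix a b c d a' b' c' d' assume FG: "F = mat22 a b c d" "G = mat22 a' b' c' d'"
  have 1: "a' = a" "c' = c" "a * d - b * c = 1" "a * d' - b' * c = 1"
    using assms FG by auto
  have "a * (d * b' - b * d') = (a * d - b * c) * b' - b * (a * d' - b' * c)"
    by (simp add: algebra_simps)
  moreover have "c * (d * b' - b * d') = (a * d - b * c) * d' - d * (a * d' - b' * c)"
    by (simp add: algebra_simps)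
  \<comment> \<open>The parameter is the upper right entry of \<open>sinv F ** G\<close>.\<close>
  ultimately have "G = F ** up (d * b' - b * d')"
    using 1 by (simp add: FG up_def)
  then show ?thesis ..
qed

lemma fst_frame [simp]: "fst (frame F) = mob F \<i>"
  by (simp add: frame_def tact_def)

text \<open>Equal endpoints make the first columns proportional, and equal heights force the factor
  to be 1 or -1. The sign is absorbed by \<open>frame_uminus\<close>.\<close>

lemma Hss_frame_imp:
  assumes F: "det F = 1" and w: "w \<in> Hss (frame F)"
  shows "\<exists>s. w = frame (F ** up s)"
proof -
  obtain G where G: "det G = 1" "w = frame G"
    using w T1H_imp_frame[of w] by (auto simp: Hss_def)
  have bd: "bact G None = bact F None"
    using w F G by (simp add: Hss_def vplus_frame)
  have "height (bact F None) (mob G \<i>) = height (bact F None) (mob F \<i>)"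
    using w G F mob_in_HH[of _ \<i>] by (simp add: Hss_def busemann_eq_0_iff vplus_frame)
  then have k: "(if G$2$1 = 0 then (G$1$1)\<^sup>2 else (G$2$1)\<^sup>2) = (if F$2$1 = 0 then (F$1$1)\<^sup>2 else (F$2$1)\<^sup>2)"
    using height_mob[OF F, of \<i>] height_mob[OF G(1), of \<i>] bd by simp
  have par: "G$1$1 * F$2$1 = F$1$1 * G$2$1"
    using bd bact_eq_iff[OF G(1) F] by simp
  have z: "G$2$1 = 0 \<longleftrightarrow> F$2$1 = 0"
    using bd by (auto simp: bact_def split: if_splits)
  have "(F$1$1 = G$1$1 \<and> F$2$1 = G$2$1) \<or> (F$1$1 = - G$1$1 \<and> F$2$1 = - G$2$1)"
  proof (cases "F$2$1 = 0")
    case True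
    then show ?thesis using k z by (auto simp: power2_eq_iff)
  next
    case False
    then have "G$2$1 = F$2$1 \<or> G$2$1 = - F$2$1"
      using k z by (auto simp: power2_eq_iff)
    then show ?thesis
    proof
      assume *: "G$2$1 = - F$2$1"
      then have "(G$1$1 + F$1$1) * F$2$1 = 0"
        using par by (simp add: algebra_simps)
      then show ?thesis using False * by simp
    qed (use par False in simp)
  qed
  then show ?thesis
  proof
    assume "F$1$1 = G$1$1 \<and> F$2$1 = G$2$1"
    then show ?thesis
      using same_first_column[OF F G(1)] G(2) by auto
  next
    assume "F$1$1 = - G$1$1 \<and> F$2$1 = - G$2$1"
    then have "\<exists>s. - G = F ** up s"
      using F G by (intro same_first_column) (simp_all add: det_2)
    then show ?thesis
      using G(2) frame_uminus by metis
  qed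
qed

lemma in_own_Hss: "det F = 1 \<Longrightarrow> frame F \<in> Hss (frame F)"
  using frame_in_T1H[of F] mob_in_HH[of F \<i>] by (simp add: Hss_def busemann_eq_0_iff)

lemma horocycle_iff:
  assumes "0 < Im z"
  shows "w \<in> horocycle \<xi> z \<longleftrightarrow> 0 < Im w \<and> height \<xi> w = height \<xi> z"
  using assms by (auto simp: horocycle_def busemann_eq_0_iff)

lemma horocycle_frame_iff:
  assumes "det K = 1" "0 < Im y" "0 < Im z"
  shows "mob K y \<in> horocycle (bact K None) (mob K z) \<longleftrightarrow> Im y = Im z"
proof -
  have "(if K$2$1 = 0 then (K$1$1)\<^sup>2 else (K$2$1)\<^sup>2) \<noteq> 0"
    using assms(1) by (auto simp: det_2)
  then show ?thesis
    using assms by (simp add: horocycle_iff mob_in_HH height_mob)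
qed

section \<open>The distance on the unit tangent bundle\<close>

lemma d1_frame:
  assumes "det F = 1" "det G = 1"
  shows "d1 (frame F) (frame G) = hdist (mob F \<i>) (mob G \<i>) +
    hdist (mob F (complex_of_real (exp 1) * \<i>)) (mob G (complex_of_real (exp 1) * \<i>))"
  by (simp add: d1_def geod_frame assms)

lemma d1_nonneg: "det F = 1 \<Longrightarrow> det G = 1 \<Longrightarrow> 0 \<le> d1 (frame F) (frame G)"
  by (simp add: d1_frame hdist_nonneg mob_in_HH)

lemma d1_self [simp]: "d1 v v = 0"
  by (simp add: d1_def)

lemma d1_triangle:
  assumes "det F = 1" "det G = 1" "det H = 1"
  shows "d1 (frame F) (frame H) \<le> d1 (frame F) (frame G) + d1 (frame G) (frame H)"
  using hdist_triangle[of "mob F \<i>" "mob G \<i>" "mob H \<i>"]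
    hdist_triangle[of "mob F (complex_of_real (exp 1) * \<i>)" "mob G (complex_of_real (exp 1) * \<i>)" "mob H (complex_of_real (exp 1) * \<i>)"]
  by (simp add: d1_frame assms mob_in_HH)

lemma d1_left_invariant:
  assumes "det A = 1" "det F = 1" "det G = 1"
  shows "d1 (frame (A ** F)) (frame (A ** G)) = d1 (frame F) (frame G)"
  by (simp add: d1_frame assms det_mult_1 mob_mult hdist_mob mob_in_HH)

text \<open>For determinant 1 the right side is half the sum of the squared entries. The form chosen
  shows that a small displacement of \<open>\<i>\<close> controls \<open>a - d\<close> and
  \<open>b + c\<close>, but not directly the rotation part \<open>b - c\<close>.\<close>

lemma cosh_hdist_mob_i:
  assumes "det M = 1"
  shows "cosh (hdist \<i> (mob M \<i>)) = 1 + ((M$1$1 - M$2$2)\<^sup>2 + (M$1$2 + M$2$1)\<^sup>2) / 2"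
proof (cases M rule: mat22_cases)
  case (1 a b c d)
  let ?q = "complex_of_real c * \<i> + d"
  have q: "?q \<noteq> 0"
    using mob_denom_nonzero[of a b c d \<i>] assms 1 by auto
  have "\<i> - mob M \<i> = (complex_of_real (- b - c) + complex_of_real (d - a) * \<i>) / ?q"
    using q by (simp add: 1 field_simps)
  moreover have "(cmod (complex_of_real (- b - c) + complex_of_real (d - a) * \<i>))\<^sup>2 = (a - d)\<^sup>2 + (b + c)\<^sup>2"
    unfolding cmod_power2 by (simp add: power2_eq_square algebra_simps)
  ultimately have "(cmod (\<i> - mob M \<i>))\<^sup>2 = ((a - d)\<^sup>2 + (b + c)\<^sup>2) / (cmod ?q)\<^sup>2"
    by (simp only: norm_divide power_divide)
  moreover have "Im (mob M \<i>) = 1 / (cmod ?q)\<^sup>2"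
    using Im_mob[OF assms, of \<i>] by (simp add: 1)
  ultimately show ?thesis
    using cosh_hdist[of \<i> "mob M \<i>"] mob_in_HH[OF assms, of \<i>] q by (simp add: 1 del: mob_mat22)
qed

text \<open>The mechanism behind the estimates below: forward flow contracts the upper right entry
  and expands the lower left one.\<close>

lemma aflow_conj: "aflow (- t) ** mat22 a b c d ** aflow t = mat22 a (b * exp (- t)) (c * exp t) d"
  by (simp add: aflow_def mult.commute mult.left_commute flip: exp_add)

lemma aflow_inverse: "sinv (aflow t) = aflow (- t)"
  by (simp add: aflow_def)

lemma hdist_mob_conj:
  assumes "det M = 1" "det F = 1"
  shows "hdist (mob F \<i>) (mob M (mob F \<i>)) = hdist \<i> (mob (sinv F ** M ** F) \<i>)"
proof -
  have "hdist (mob (sinv F) (mob F \<i>)) (mob (sinv F) (mob M (mob F \<i>))) = hdist (mob F \<i>) (mob M (mob F \<i>))"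
    using assms by (intro hdist_mob) (simp_all add: mob_in_HH)
  then show ?thesis
    using assms by (simp add: mob_mult mob_in_HH mob_sinv det_mult_1)
qed

lemma d1_identity_small:
  assumes "0 < \<epsilon>"
  shows "\<exists>\<eta>>0. \<forall>a b c d. a * d - b * c = 1 \<longrightarrow> \<bar>a - d\<bar> \<le> \<eta> \<longrightarrow> \<bar>b\<bar> \<le> \<eta> \<longrightarrow> \<bar>c\<bar> \<le> \<eta> \<longrightarrow>
    d1 (frame (mat 1)) (frame (mat22 a b c d)) \<le> \<epsilon>"
proof -
  \<comment> \<open>The bound used below is \<open>\<bar>b + c\<bar> \<le> 4 * \<eta>\<close>:
    comparison at time 1 multiplies \<open>c\<close> by \<open>exp 1 \<le> 3\<close>. Then
    \<open>(1 + 16) / 2 \<le> 9\<close> explains the denominator.\<close>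
  define \<eta> where "\<eta> = sqrt ((cosh (\<epsilon> / 2) - 1) / 9)"
  have c1: "1 < cosh (\<epsilon> / 2)"
    using cosh_real_strict_mono[of 0 "\<epsilon> / 2"] assms by simp
  then have \<eta>: "0 < \<eta>" "9 * \<eta>\<^sup>2 = cosh (\<epsilon> / 2) - 1"
    by (auto simp: \<eta>_def)
  have small: "hdist \<i> (mob (mat22 a b c d) \<i>) \<le> \<epsilon> / 2"
    if "a * d - b * c = 1" "\<bar>a - d\<bar> \<le> \<eta>" "\<bar>b + c\<bar> \<le> 4 * \<eta>" for a b c d
  proof -
    have det: "det (mat22 a b c d) = 1" using that by simp
    have "\<bar>a - d\<bar> \<le> \<bar>\<eta>\<bar>" "\<bar>b + c\<bar> \<le> \<bar>4 * \<eta>\<bar>"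
      using that \<eta>(1) by auto
    then have sq: "(a - d)\<^sup>2 \<le> \<eta>\<^sup>2" "(b + c)\<^sup>2 \<le> 16 * \<eta>\<^sup>2"
      unfolding abs_le_square_iff power_mult_distrib by simp_all
    have "x / 2 \<le> 9 * h" if "x = u + v" "u \<le> h" "v \<le> 16 * h" "0 \<le> h" for x u v h :: real
      using that by simp
    from this[OF refl sq] have "((a - d)\<^sup>2 + (b + c)\<^sup>2) / 2 \<le> cosh (\<epsilon> / 2) - 1"
      unfolding \<eta>(2) by simp
    then have "cosh (hdist \<i> (mob (mat22 a b c d) \<i>)) \<le> cosh (\<epsilon> / 2)"
      unfolding cosh_hdist_mob_i[OF det] mat22_nth by (simp only: le_diff_eq add.commute)
    moreover have "0 \<le> hdist \<i> (mob (mat22 a b c d) \<i>)"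
      by (rule hdist_nonneg) (use mob_in_HH[OF det] in simp_all)
    ultimately show ?thesis
      using assms by (subst (asm) cosh_real_nonneg_le_iff) auto
  qed
  show ?thesis
  proof (intro exI[of _ \<eta>] conjI allI impI)
    fix a b c d :: real
    assume abcd: "a * d - b * c = 1" "\<bar>a - d\<bar> \<le> \<eta>" "\<bar>b\<bar> \<le> \<eta>" "\<bar>c\<bar> \<le> \<eta>"
    let ?M = "mat22 a b c d"
    have det: "det ?M = 1" using abcd by simp
    have e: "exp (- 1) \<le> (1::real)" "exp 1 \<le> (3::real)"
      using exp_le by auto
    have "hdist \<i> (mob ?M \<i>) \<le> \<epsilon> / 2"
      using abcd by (intro small) auto
    moreover have "hdist (complex_of_real (exp 1) * \<i>) (mob ?M (complex_of_real (exp 1) * \<i>)) \<le> \<epsilon> / 2"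
    proof -
      have "hdist (complex_of_real (exp 1) * \<i>) (mob ?M (complex_of_real (exp 1) * \<i>)) =
        hdist \<i> (mob (mat22 a (b * exp (- 1)) (c * exp 1) d) \<i>)"
        using hdist_mob_conj[OF det det_aflow[of 1]] unfolding aflow_inverse aflow_conj by simp
      moreover have "\<bar>b * exp (- 1) + c * exp 1\<bar> \<le> 4 * \<eta>"
      proof -
        have "\<bar>b\<bar> * exp (- 1) \<le> \<eta> * 1" "\<bar>c\<bar> * exp 1 \<le> \<eta> * 3"
          using abcd \<eta> e by (intro mult_mono; simp)+
        then show ?thesis
          using abs_triangle_ineq[of "b * exp (- 1)" "c * exp 1"] by (simp add: abs_mult)
      qed
      moreover have "a * d - (b * exp (- 1)) * (c * exp 1) = 1"
      proof -
        have "(b * exp (- 1)) * (c * exp 1) = b * c * (exp 1 * exp (- 1))"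
          by (simp only: ac_simps)
        then show ?thesis using abcd by (simp only: exp_minus_inverse mult_1_right)
      qed
      ultimately show ?thesis
        using abcd small[of a d "b * exp (- 1)" "c * exp 1"] by simp
    qed
    ultimately show "d1 (frame (mat 1)) (frame ?M) \<le> \<epsilon>"
      using d1_frame[of "mat 1" ?M] det by (simp del: mob_mat22)
  qed (use \<eta> in simp)
qed

text \<open>Each point has a member of a countable basis that meets \<open>S\<close> in this point
  alone; choosing one gives an injection of \<open>S\<close> into the basis.\<close>

lemma countable_isolated:
  fixes S :: "'a :: {metric_space, second_countable_topology} set"
  assumes "\<forall>x\<in>S. \<exists>e>0. \<forall>y\<in>S. dist x y < e \<longrightarrow> y = x"
  shows "countable S"
proof -
  obtain \<B> :: "'a set set" where "countable \<B> \<and> topological_basis \<B>"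
    using ex_countable_basis ..
  then have \<B>: "countable \<B>" "topological_basis \<B>" by simp_all
  have "\<exists>U\<in>\<B>. U \<inter> S = {x}" if x: "x \<in> S" for x
  proof -
    obtain e where e: "0 < e" "\<forall>y\<in>S. dist x y < e \<longrightarrow> y = x"
      using bspec[OF assms x] by (elim exE conjE)
    have "x \<in> ball x e" using e by simp
    then obtain U where U: "U \<in> \<B>" "x \<in> U" "U \<subseteq> ball x e"
      by (rule topological_basisE[OF \<B>(2) open_ball])
    have "y = x" if "y \<in> U" "y \<in> S" for y
      using bspec[OF e(2) that(2)] subsetD[OF U(3) that(1)] by simp
    then have "U \<inter> S = {x}"
      using U(2) x by fast
    with U(1) show ?thesis by (rule bexI[rotated])
  qed
  then have "\<forall>x\<in>S. \<exists>U. U \<in> \<B> \<and> U \<inter> S = {x}"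
    by blast
  from bchoice[OF this] obtain U where U: "\<forall>x\<in>S. U x \<in> \<B> \<and> U x \<inter> S = {x}" ..
  have "inj_on U S"
  proof (rule inj_onI)
    fix x y assume xy: "x \<in> S" "y \<in> S" "U x = U y"
    have "U x \<inter> S = {x}" "U y \<inter> S = {y}" using U xy(1,2) by auto
    then show "x = y" unfolding xy(3) by simp
  qed
  moreover have "countable (U ` S)"
    by (rule countable_subset[OF _ \<B>(1)]) (use U in auto)
  ultimately show ?thesis
    by (rule countable_image_inj_on[rotated])
qed

section \<open>Lengths of closed horocycles\<close>

text \<open>The right side is the length of the horocyclic arc between the points; the estimate
  comes from \<open>x \<le> sinh x\<close>.\<close>

lemma hdist_same_height:
  assumes "0 < Im z" "Im w = Im z"
  shows "hdist z w \<le> \<bar>Re z - Re w\<bar> / Im z"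
proof -
  have w: "0 < Im w" using assms by simp
  have "cmod (z - w) = \<bar>Re z - Re w\<bar>"
    using assms by (simp add: cmod_def)
  then have "sinh (hdist z w / 2) = \<bar>Re z - Re w\<bar> / (2 * Im z)"
    using assms by (simp add: sinh_half_hdist[OF assms(1) w])
  moreover have "x \<le> sinh x" if "0 \<le> x" for x :: real
  proof -
    have "sinh 0 - 0 \<le> sinh x - x"
    proof (rule DERIV_nonneg_imp_nondecreasing[OF that])
      fix y :: real
      show "\<exists>D. ((\<lambda>x. sinh x - x) has_real_derivative D) (at y) \<and> 0 \<le> D"
        by (intro exI[of _ "cosh y - 1"] conjI)
          (auto intro!: derivative_eq_intros simp: cosh_real_ge_1)
    qed
    then show ?thesis by simp
  qed
  from this[of "hdist z w / 2"] have "hdist z w / 2 \<le> sinh (hdist z w / 2)"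
    using hdist_nonneg[OF assms(1) w] by simp
  ultimately show ?thesis by simp
qed

text \<open>A continuous injection puts interior values strictly between the end values. On
  \<open>{0..1}\<close> this gives \<open>f s \<le> f 1\<close>, and on \<open>{s..1}\<close> it
  then places \<open>f t\<close> above \<open>f s\<close>.\<close>

lemma continuous_inj_imp_mono_unit_interval:
  fixes f :: "real \<Rightarrow> real"
  assumes cont: "continuous_on {0..1} f" and inj: "inj_on f {0..1}" and less: "f 0 < f 1"
    and st: "0 \<le> s" "s \<le> t" "t \<le> 1"
  shows "f s \<le> f t"
proof -
  have ends: "f 0 \<le> f s \<and> f s \<le> f 1" if s: "0 \<le> s" "s \<le> 1" for s
  proof -
    consider "s = 0" | "s = 1" | "0 < s" "s < 1" using s by fastforce
    then show ?thesis
      using continuous_inj_imp_mono[OF _ _ cont inj, of s] less by cases auto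
  qed
  consider "s = t" | "t = 1" | "s < t" "t < 1" using st by fastforce
  then show ?thesis
  proof cases
    case 3
    have "continuous_on {s..1} f" "inj_on f {s..1}"
      using st by (auto intro: continuous_on_subset[OF cont] inj_on_subset[OF inj])
    from continuous_inj_imp_mono[OF 3 this] show ?thesis
      using ends[of s] st 3 by auto
  qed (use ends st in auto)
qed

text \<open>The substance is that the polygonal sums are bounded, so that the supremum is
  meaningful. The isometric copy \<open>q\<close> of the path lies in a horizontal line, where
  injectivity makes the real part monotone; the arc length bounds then telescope.\<close>

lemma hlength_ge:
  assumes h: "\<And>r. r \<in> {0..1} \<Longrightarrow> Im (q r) = h" "0 < h"
    and cont: "continuous_on {0..1} q" and inj: "inj_on q {0..1}"
    and p: "\<And>r r'. r \<in> {0..1} \<Longrightarrow> r' \<in> {0..1} \<Longrightarrow> hdist (p r) (p r') = hdist (q r) (q r')"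
  shows "hdist (p 0) (p 1) \<le> hlength p"
proof -
  define f where "f r = Re (q r)" for r
  have cf: "continuous_on {0..1} f"
    unfolding f_def by (intro continuous_intros cont)
  have inf: "inj_on f {0..1}"
    using inj h(1) unfolding inj_on_def f_def by (metis complex_eqI)
  have mono: "(\<forall>s t. 0 \<le> s \<longrightarrow> s \<le> t \<longrightarrow> t \<le> 1 \<longrightarrow> f s \<le> f t) \<or> (\<forall>s t. 0 \<le> s \<longrightarrow> s \<le> t \<longrightarrow> t \<le> 1 \<longrightarrow> - f s \<le> - f t)"
  proof (cases "f 0 < f 1")
    case True
    then show ?thesis using continuous_inj_imp_mono_unit_interval[OF cf inf] by blast
  next
    case False
    have "f 0 \<noteq> f 1" using inj_onD[OF inf, of 0 1] by auto
    then have "- f 0 < - f 1" using False by simp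
    moreover have "continuous_on {0..1} (\<lambda>x. - f x)" "inj_on (\<lambda>x. - f x) {0..1}"
      using inf by (auto intro: continuous_intros cf simp: inj_on_def)
    ultimately show ?thesis
      using continuous_inj_imp_mono_unit_interval[of "\<lambda>x. - f x"] by blast
  qed
  let ?S = "{(\<Sum>i<n. hdist (p (ts i)) (p (ts (Suc i)))) | n ts.
      ts 0 = 0 \<and> ts n = 1 \<and> (\<forall>i<n. ts i \<le> ts (Suc i))}"
  have "x \<le> \<bar>f 1 - f 0\<bar> / h" if x: "x \<in> ?S" for x
  proof -
    obtain n ts where x: "x = (\<Sum>i<n. hdist (p (ts i)) (p (ts (Suc i))))"
      and ts: "ts 0 = 0" "ts n = 1" "\<And>i. i < n \<Longrightarrow> ts i \<le> ts (Suc i)"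
      using x by auto
    have mts: "ts i \<le> ts j" if "i \<le> j" "j \<le> n" for i j
      using that
    proof (induction j rule: dec_induct)
      case (step m)
      then show ?case using ts(3)[of m] by simp
    qed simp
    have rng: "0 \<le> ts i \<and> ts i \<le> 1" if "i \<le> n" for i
      using mts[of 0 i] mts[of i n] that ts by auto
    have "x \<le> (\<Sum>i<n. \<bar>f (ts (Suc i)) - f (ts i)\<bar> / h)"
      unfolding x
    proof (rule sum_mono)
      fix i assume "i \<in> {..<n}"
      then have r: "ts i \<in> {0..1}" "ts (Suc i) \<in> {0..1}"
        using rng[of i] rng[of "Suc i"] by auto
      then show "hdist (p (ts i)) (p (ts (Suc i))) \<le> \<bar>f (ts (Suc i)) - f (ts i)\<bar> / h"
        using hdist_same_height[of "q (ts i)" "q (ts (Suc i))"] h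
        by (simp add: p f_def abs_minus_commute)
    qed
    also have "\<dots> = \<bar>\<Sum>i<n. f (ts (Suc i)) - f (ts i)\<bar> / h"
      using mono
    proof
      assume m: "\<forall>s t. 0 \<le> s \<longrightarrow> s \<le> t \<longrightarrow> t \<le> 1 \<longrightarrow> f s \<le> f t"
      have pos: "0 \<le> f (ts (Suc i)) - f (ts i)" if "i < n" for i
        using m rng[of i] rng[of "Suc i"] ts(3)[of i] that by simp
      have "(\<Sum>i<n. \<bar>f (ts (Suc i)) - f (ts i)\<bar>) = (\<Sum>i<n. f (ts (Suc i)) - f (ts i))"
        using pos by (intro sum.cong) auto
      moreover have "0 \<le> (\<Sum>i<n. f (ts (Suc i)) - f (ts i))"
        using pos by (intro sum_nonneg) auto
      ultimately show ?thesis by (simp flip: sum_divide_distrib)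
    next
      assume m: "\<forall>s t. 0 \<le> s \<longrightarrow> s \<le> t \<longrightarrow> t \<le> 1 \<longrightarrow> - f s \<le> - f t"
      have neg: "f (ts (Suc i)) - f (ts i) \<le> 0" if "i < n" for i
        using m rng[of i] rng[of "Suc i"] ts(3)[of i] that by simp
      have "(\<Sum>i<n. \<bar>f (ts (Suc i)) - f (ts i)\<bar>) = (\<Sum>i<n. - (f (ts (Suc i)) - f (ts i)))"
        using neg by (intro sum.cong) auto
      moreover have "(\<Sum>i<n. f (ts (Suc i)) - f (ts i)) \<le> 0"
        using neg by (intro sum_nonpos) auto
      ultimately show ?thesis by (simp only: sum_negf flip: sum_divide_distrib) simp
    qed
    also have "(\<Sum>i<n. f (ts (Suc i)) - f (ts i)) = f 1 - f 0"
      using sum_lessThan_telescope[of "\<lambda>i. f (ts i)" n] ts by simp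
    finally show ?thesis .
  qed
  then have "bdd_above ?S"
    by (rule bdd_aboveI)
  \<comment> \<open>The partition with the single step from 0 to 1.\<close>
  moreover have "hdist (p 0) (p 1) \<in> ?S"
    by (rule CollectI, intro exI[of _ 1] exI[of _ real]) simp
  ultimately show ?thesis
    unfolding hlength_def by (intro cSup_upper)
qed

text \<open>In coordinates where the fixed point is infinity, an element of its stabiliser has
  vanishing lower left entry. The trace is kept so that parabolicity can be read off from
  \<open>\<alpha>\<close>.\<close>

lemma fixes_bdry_imp_upper_triangular:
  assumes "det K = 1" "det A = 1" "bact A (bact K None) = bact K None"
  obtains \<alpha> \<beta> where "\<alpha> \<noteq> 0" "sinv K ** A ** K = mat22 \<alpha> \<beta> 0 (1 / \<alpha>)" "A$1$1 + A$2$2 = \<alpha> + 1 / \<alpha>"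
proof (cases K rule: mat22_cases, cases A rule: mat22_cases)
  fix a b c d a' b' c' d' assume KA: "K = mat22 a b c d" "A = mat22 a' b' c' d'"
  define T where "T = sinv K ** A ** K"
  have detT: "det T = 1" using assms by (simp add: T_def det_mult_1)
  have "bact (A ** K) None = bact K None"
    using assms by (simp add: bact_mult)
  then have "(A ** K)$1$1 * K$2$1 = K$1$1 * (A ** K)$2$1"
    using bact_eq_iff[of "A ** K" K] assms by (simp add: det_mult_1)
  then have T21: "T$2$1 = 0"
    by (simp add: T_def KA algebra_simps)
  have "T$1$1 + T$2$2 = (a' + d') * (a * d - b * c)"
    by (simp add: T_def KA algebra_simps)
  also have "a * d - b * c = 1" using assms KA by simp
  finally have tr: "T$1$1 + T$2$2 = A$1$1 + A$2$2" by (simp add: KA)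
  have "T$1$1 * T$2$2 = 1" using detT T21 by (simp add: det_2)
  then have T22: "T$1$1 \<noteq> 0" "T$2$2 = 1 / T$1$1"
    by (auto simp: eq_divide_eq mult.commute)
  have "T = mat22 (T$1$1) (T$1$2) 0 (1 / T$1$1)"
    by (rule mat22_eqI) (simp_all add: T21 T22)
  then show ?thesis
    using that[of "T$1$1" "T$1$2"] T22 tr unfolding T_def by metis
qed

lemma is_pm_id_conj:
  assumes "det K = 1" "is_pm_id (sinv K ** A ** K)"
  shows "is_pm_id A"
proof -
  have A: "A = K ** (sinv K ** A ** K) ** sinv K"
    using assms(1) by (metis matrix_mul_assoc matrix_mul_rid sinv_cancel(2) sinv_right)
  have "K ** (- mat 1) ** sinv K = - mat 1"
    using assms(1) by (cases K rule: mat22_cases) (simp add: mat_1_eq_mat22 algebra_simps)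
  then show ?thesis
    using assms A unfolding is_pm_id_def by (metis matrix_mul_rid sinv_right)
qed

lemma continuous_on_mob:
  assumes "det A = 1" "\<And>z. z \<in> S \<Longrightarrow> 0 < Im z"
  shows "continuous_on S (mob A)"
proof (rule DERIV_continuous_on)
  fix z assume "z \<in> S"
  then show "(mob A has_field_derivative 1 / (complex_of_real (A$2$1) * z + complex_of_real (A$2$2))\<^sup>2) (at z within S)"
    by (intro has_field_derivative_at_within[OF mob_has_field_derivative] assms)
qed

text \<open>An element \<open>A\<close> competing in the infimum maps \<open>z\<close> to the same
  horocycle, which forces it to be parabolic. In horizontal coordinates it is a translation, so it
  displaces all points of the horocycle equally, by less than the length of the path.\<close>

lemma closed_horo_length_less_imp:
  assumes dets: "\<And>A. A \<in> \<Gamma> \<Longrightarrow> det A = 1" and pf: "parabolic_fixed \<Gamma> \<xi>" and z: "0 < Im z"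
    and less: "closed_horo_length \<Gamma> \<xi> z < \<epsilon>"
  shows "\<exists>A\<in>\<Gamma>. parabolic A \<and> (\<forall>y\<in>horocycle \<xi> z. hdist y (mob A y) < \<epsilon>)"
proof -
  obtain K where K: "det K = 1" "bact K None = \<xi>"
    by (rule bdry_frame)
  define y0 where "y0 = mob (sinv K) z"
  have y0: "0 < Im y0" "mob K y0 = z"
    using K z by (simp_all add: y0_def mob_in_HH mob_sinv')
  let ?P = "\<lambda>(p :: real \<Rightarrow> complex) A. A \<in> \<Gamma> \<and> \<not> is_pm_id A \<and> bact A \<xi> = \<xi> \<and>
      continuous_on {0..1} p \<and> inj_on p {0..1} \<and> p ` {0..1} \<subseteq> horocycle \<xi> z \<and>
      p 0 = z \<and> p 1 = mob A z"
  have upper: "mob A (mob K y) = mob K (complex_of_real (\<alpha>\<^sup>2) * y + complex_of_real (\<alpha> * \<beta>))"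
    if "det A = 1" "\<alpha> \<noteq> 0" "sinv K ** A ** K = mat22 \<alpha> \<beta> 0 (1 / \<alpha>)" "0 < Im y" for A \<alpha> \<beta> y
  proof -
    have "mob A (mob K y) = mob (A ** K) y"
      using that K by (simp add: mob_mult)
    also have "A ** K = K ** (sinv K ** A ** K)"
      using sinv_cancel(2)[OF K(1)] by (metis matrix_mul_assoc)
    also have "mob \<dots> y = mob K (mob (sinv K ** A ** K) y)"
      using that K by (intro mob_mult) (simp_all add: det_mult_1)
    also have "mob (sinv K ** A ** K) y = complex_of_real (\<alpha>\<^sup>2) * y + complex_of_real (\<alpha> * \<beta>)"
      using that by (simp add: field_simps power2_eq_square)
    finally show ?thesis .
  qed
  \<comment> \<open>Without a competing path the infimum would carry no information. The path is a
    horizontal segment transported by \<open>K\<close>.\<close>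
  have nonempty: "\<exists>p A. ?P p A"
  proof -
    obtain A where A: "A \<in> \<Gamma>" "parabolic A" "bact A \<xi> = \<xi>"
      using pf by (auto simp: parabolic_fixed_def)
    obtain \<alpha> \<beta> where ab: "\<alpha> \<noteq> 0" "sinv K ** A ** K = mat22 \<alpha> \<beta> 0 (1 / \<alpha>)" "A$1$1 + A$2$2 = \<alpha> + 1 / \<alpha>"
      using fixes_bdry_imp_upper_triangular[OF K(1) dets[OF A(1)]] A K by auto
    have "\<alpha> + 1 / \<alpha> = 2 \<or> \<alpha> + 1 / \<alpha> = - 2"
      using A(2) ab(3) by (auto simp: parabolic_def abs_eq_iff')
    then have "(\<alpha> - 1)\<^sup>2 = 0 \<or> (\<alpha> + 1)\<^sup>2 = 0"
      using ab(1) by (auto simp: field_simps power2_eq_square)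
    then have \<alpha>: "\<alpha> = 1 \<or> \<alpha> = - 1" by auto
    then have \<alpha>2: "\<alpha>\<^sup>2 = 1" by auto
    have "\<not> is_pm_id (sinv K ** A ** K)"
      using A(2) is_pm_id_conj[OF K(1)] by (auto simp: parabolic_def)
    then have \<beta>: "\<beta> \<noteq> 0"
      using \<alpha> unfolding ab(2) is_pm_id_def mat_1_eq_mat22 by auto
    define c where "c = complex_of_real (\<alpha> * \<beta>)"
    have c: "c \<noteq> 0" "Im c = 0" using \<beta> ab(1) by (simp_all add: c_def)
    define p where "p r = mob K (y0 + complex_of_real r * c)" for r
    have H: "0 < Im (y0 + complex_of_real r * c)" for r using y0 c by simp
    have "?P p A"
    proof (intro conjI)
      show "continuous_on {0..1} p"
      proof -
        have "continuous_on (range (\<lambda>r. y0 + complex_of_real r * c)) (mob K)"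
          by (rule continuous_on_mob[OF K(1)]) (use H in auto)
        then show ?thesis
          unfolding p_def[abs_def]
          by (rule continuous_on_compose2) (auto intro!: continuous_intros)
      qed
      show "inj_on p {0..1}"
      proof (rule inj_onI)
        fix r s assume "p r = p s"
        then have "y0 + complex_of_real r * c = y0 + complex_of_real s * c"
          unfolding p_def using H mob_sinv[OF K(1)] by metis
        then show "r = s" using c by simp
      qed
      show "p ` {0..1} \<subseteq> horocycle \<xi> z"
      proof -
        have "p r \<in> horocycle (bact K None) (mob K y0)" for r
          unfolding p_def using H y0 c K by (subst horocycle_frame_iff) auto
        then show ?thesis using K y0 by auto
      qed
      show "p 0 = z" using y0 by (simp add: p_def)
      show "p 1 = mob A z"
        using upper[OF dets[OF A(1)] ab(1,2) y0(1)] y0 by (simp add: p_def c_def \<alpha>2)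
      show "\<not> is_pm_id A" using A(2) by (simp add: parabolic_def)
    qed (use A in auto)
    then show ?thesis by (intro exI)
  qed
  have "\<exists>x\<in>{hlength p | p A. ?P p A}. x < \<epsilon>"
  proof (rule cInf_lessD)
    show "{hlength p | p A. ?P p A} \<noteq> {}"
      using nonempty by (simp only: Collect_empty_eq) blast
  qed (use less in \<open>simp only: closed_horo_length_def\<close>)
  then obtain x where x: "x \<in> {hlength p | p A. ?P p A}" "x < \<epsilon>" ..
  from x(1) obtain p A where pA: "x = hlength p \<and> ?P p A"
    unfolding mem_Collect_eq by (elim exE)
  then have p: "?P p A" "hlength p < \<epsilon>"
    using x(2) by simp_all
  then have A: "A \<in> \<Gamma>" "det A = 1" and pmA: "\<not> is_pm_id A" using dets by auto
  obtain \<alpha> \<beta> where ab: "\<alpha> \<noteq> 0" "sinv K ** A ** K = mat22 \<alpha> \<beta> 0 (1 / \<alpha>)" "A$1$1 + A$2$2 = \<alpha> + 1 / \<alpha>"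
  proof (rule fixes_bdry_imp_upper_triangular[OF K(1) A(2)])
    show "bact A (bact K None) = bact K None" using p K by simp
  qed
  define q where "q r = mob (sinv K) (p r)" for r
  have pc: "continuous_on {0..1} p" and pinj: "inj_on p {0..1}" and p01: "p 0 = z" "p 1 = mob A z"
    using p(1) by simp_all
  have p_horo: "p r \<in> horocycle \<xi> z" if "r \<in> {0..1}" for r
    using p(1) that by (auto simp: image_subset_iff)
  have pH: "0 < Im (p r)" if "r \<in> {0..1}" for r
    using p_horo[OF that] by (simp add: horocycle_def)
  have q: "0 < Im (q r)" "p r = mob K (q r)" if "r \<in> {0..1}" for r
    using pH[OF that] K by (simp_all add: q_def mob_in_HH mob_sinv')
  have Imq: "Im (q r) = Im y0" if "r \<in> {0..1}" for r
  proof -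
    have "mob K (q r) \<in> horocycle (bact K None) (mob K y0)"
      using p_horo[OF that] q(2)[OF that] K y0 by simp
    then show ?thesis
      using horocycle_frame_iff K(1) q(1)[OF that] y0(1) by blast
  qed
  have cq: "continuous_on {0..1} q"
  proof -
    have "continuous_on (p ` {0..1}) (mob (sinv K))"
    proof (rule continuous_on_mob)
      show "det (sinv K) = 1" using K by simp
      show "0 < Im w" if "w \<in> p ` {0..1}" for w using that pH by (elim imageE) simp
    qed
    then show ?thesis
      unfolding q_def[abs_def] by (rule continuous_on_compose2[OF _ pc]) (rule order_refl)
  qed
  have iq: "inj_on q {0..1}"
  proof (rule inj_onI)
    fix r r' assume r: "r \<in> {0..1}" "r' \<in> {0..1}" "q r = q r'"
    then have "p r = p r'" using q(2) by simp
    then show "r = r'" using inj_onD[OF pinj] r by simp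
  qed
  have hp: "hdist (p r) (p r') = hdist (q r) (q r')" if "r \<in> {0..1}" "r' \<in> {0..1}" for r r'
    using that q by (simp add: hdist_mob K)
  have "hdist (p 0) (p 1) < \<epsilon>"
    using hlength_ge[of q "Im y0" p, OF Imq y0(1) cq iq hp] p(2) by (rule le_less_trans)
  then have less': "hdist z (mob A z) < \<epsilon>"
    by (simp add: p01)
  have Az: "mob A z = mob K (complex_of_real (\<alpha>\<^sup>2) * y0 + complex_of_real (\<alpha> * \<beta>))"
    using upper[OF A(2) ab(1,2) y0(1)] y0 by simp
  have "p 1 \<in> horocycle \<xi> z"
    by (rule p_horo) simp
  then have "mob K (complex_of_real (\<alpha>\<^sup>2) * y0 + complex_of_real (\<alpha> * \<beta>)) \<in> horocycle (bact K None) (mob K y0)"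
    by (simp only: p01 Az K y0)
  \<comment> \<open>Preservation of the height rules out hyperbolic elements: it gives
    \<open>\<alpha>\<^sup>2 = 1\<close>.\<close>
  then have "Im (complex_of_real (\<alpha>\<^sup>2) * y0 + complex_of_real (\<alpha> * \<beta>)) = Im y0"
    using horocycle_frame_iff[of K _ y0] K(1) y0(1) ab(1) by simp
  then have \<alpha>2: "\<alpha>\<^sup>2 = 1" using y0(1) by simp
  then have "\<alpha> = 1 \<or> \<alpha> = - 1" by (simp add: power2_eq_1_iff)
  then have par: "parabolic A"
    using pmA ab(3) by (auto simp: parabolic_def)
  have "hdist y (mob A y) < \<epsilon>" if y: "y \<in> horocycle \<xi> z" for y
  proof -
    define y1 where "y1 = mob (sinv K) y"
    have yH: "0 < Im y" using y by (simp add: horocycle_def)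
    then have y1: "0 < Im y1" "mob K y1 = y"
      using K by (simp_all add: y1_def mob_in_HH mob_sinv')
    have Imy: "Im y1 = Im y0"
      using y K y1 y0 horocycle_frame_iff[of K y1 y0] by simp
    have tr: "hdist w (mob A w) = hdist w' (w' + complex_of_real (\<alpha> * \<beta>))" if "0 < Im w'" "w = mob K w'" for w w'
      using upper[OF A(2) ab(1,2) that(1)] that K by (simp add: \<alpha>2 hdist_mob)
    have "hdist y (mob A y) = hdist y1 (y1 + complex_of_real (\<alpha> * \<beta>))"
      by (rule tr) (simp_all add: y1)
    also have "\<dots> = hdist y0 (y0 + complex_of_real (\<alpha> * \<beta>))"
      using Imy by (simp add: hdist_def)
    also have "\<dots> = hdist z (mob A z)"
      by (rule tr[symmetric]) (simp_all add: y0)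
    finally show ?thesis using less' by simp
  qed
  then show ?thesis using par A by blast
qed

text \<open>A rotation about \<open>\<i>\<close> does not displace \<open>\<i>\<close>, yet may be
  far from the identity. Trace 2 and determinant 1 exclude this: they give
  \<open>(b - c)\<^sup>2 = (a - d)\<^sup>2 + (b + c)\<^sup>2\<close>, so the displacement controls
  the rotation part as well.\<close>

lemma near_identity_if_trace_2:
  fixes a b c d \<delta> :: real
  assumes "a * d - b * c = 1" "a + d = 2" "(a - d)\<^sup>2 + (b + c)\<^sup>2 \<le> \<delta>\<^sup>2" "0 \<le> \<delta>"
  shows "\<bar>a - 1\<bar> \<le> \<delta> \<and> \<bar>d - 1\<bar> \<le> \<delta> \<and> \<bar>b\<bar> \<le> \<delta> \<and> \<bar>c\<bar> \<le> \<delta>"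
proof -
  have d: "d = 2 - a" using assms(2) by simp
  have "(b - c)\<^sup>2 = (a - d)\<^sup>2 + (b + c)\<^sup>2 - 4 * ((a + d)\<^sup>2 / 4 - (a * d - b * c))"
    by (simp add: power2_eq_square algebra_simps)
  then have "(b - c)\<^sup>2 = (a - d)\<^sup>2 + (b + c)\<^sup>2"
    by (simp add: assms(1,2))
  moreover have "(a - d)\<^sup>2 \<le> (a - d)\<^sup>2 + (b + c)\<^sup>2" "(b + c)\<^sup>2 \<le> (a - d)\<^sup>2 + (b + c)\<^sup>2"
    by simp_all
  ultimately have "(a - d)\<^sup>2 \<le> \<delta>\<^sup>2" "(b + c)\<^sup>2 \<le> \<delta>\<^sup>2" "(b - c)\<^sup>2 \<le> \<delta>\<^sup>2"
    using assms(3) by linarith+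
  then have "\<bar>a - d\<bar> \<le> \<delta>" "\<bar>b + c\<bar> \<le> \<delta>" "\<bar>b - c\<bar> \<le> \<delta>"
    using assms(4) by (simp_all flip: abs_le_square_iff)
  then show ?thesis unfolding d by linarith
qed

lemma parabolic_conj:
  assumes "parabolic A" "det B = 1"
  shows "parabolic (B ** A ** sinv B)"
proof -
  have "(B ** A ** sinv B)$1$1 + (B ** A ** sinv B)$2$2 = (A$1$1 + A$2$2) * det B"
    by (cases A rule: mat22_cases, cases B rule: mat22_cases) (simp add: algebra_simps)
  moreover have "\<not> is_pm_id (B ** A ** sinv B)"
    using is_pm_id_conj[of "sinv B" A] assms by (auto simp: parabolic_def)
  ultimately show ?thesis
    using assms by (simp add: parabolic_def)
qed

lemma norm_mat22_le: "norm M \<le> \<bar>M$1$1\<bar> + \<bar>M$1$2\<bar> + \<bar>M$2$1\<bar> + \<bar>M$2$2\<bar>"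
  for M :: "real^2^2"
proof -
  have "norm M \<le> (\<Sum>i\<in>UNIV. norm (M $ i))"
    unfolding norm_vec_def by (rule L2_set_le_sum) simp
  also have "\<dots> \<le> (\<Sum>i\<in>UNIV. \<Sum>j\<in>UNIV. \<bar>M $ i $ j\<bar>)"
    by (intro sum_mono norm_le_l1_cart)
  finally show ?thesis by (simp add: sum_2)
qed

text \<open>Right multiplication does not preserve the Euclidean distance of matrices, so
  \<open>\<eta>\<close> depends on the entries of \<open>F\<close>.\<close>

lemma dist_mult_near_identity:
  fixes F :: "real^2^2"
  assumes "0 < \<epsilon>"
  shows "\<exists>\<eta>>0. \<forall>a b c d. \<bar>a - 1\<bar> \<le> \<eta> \<longrightarrow> \<bar>b\<bar> \<le> \<eta> \<longrightarrow> \<bar>c\<bar> \<le> \<eta> \<longrightarrow> \<bar>d - 1\<bar> \<le> \<eta> \<longrightarrow>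
    dist F (F ** mat22 a b c d) < \<epsilon>"
proof (cases F rule: mat22_cases)
  case (1 p q r s)
  define K where "K = \<bar>p\<bar> + \<bar>q\<bar> + \<bar>r\<bar> + \<bar>s\<bar>"
  define \<eta> where "\<eta> = \<epsilon> / (2 * K + 1)"
  have K: "0 \<le> K" by (simp add: K_def)
  have \<eta>: "0 < \<eta>" "2 * K * \<eta> < \<epsilon>"
    using assms K by (simp_all add: \<eta>_def field_simps)
  have "dist F (F ** mat22 a b c d) < \<epsilon>"
    if "\<bar>a - 1\<bar> \<le> \<eta>" "\<bar>b\<bar> \<le> \<eta>" "\<bar>c\<bar> \<le> \<eta>" "\<bar>d - 1\<bar> \<le> \<eta>" for a b c d
  proof -
    have e: "\<bar>x * (a - 1) + y * c\<bar> + \<bar>x * b + y * (d - 1)\<bar> \<le> 2 * (\<bar>x\<bar> + \<bar>y\<bar>) * \<eta>" for x y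
    proof -
      have "\<bar>x * u + y * v\<bar> \<le> (\<bar>x\<bar> + \<bar>y\<bar>) * \<eta>" if "\<bar>u\<bar> \<le> \<eta>" "\<bar>v\<bar> \<le> \<eta>" for u v
        using mult_left_mono[OF that(1) abs_ge_zero[of x]] mult_left_mono[OF that(2) abs_ge_zero[of y]]
          abs_triangle_ineq[of "x * u" "y * v"] by (simp add: abs_mult distrib_right)
      from add_mono[OF this[of "a - 1" c] this[of b "d - 1"]] show ?thesis
        using that by (simp add: algebra_simps)
    qed
    have "dist F (F ** mat22 a b c d) = norm (F ** mat22 a b c d - F)"
      by (metis dist_commute dist_norm)
    also have "\<dots> \<le> (\<bar>p * (a - 1) + q * c\<bar> + \<bar>p * b + q * (d - 1)\<bar>) + (\<bar>r * (a - 1) + s * c\<bar> + \<bar>r * b + s * (d - 1)\<bar>)"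
      using norm_mat22_le[of "F ** mat22 a b c d - F"] by (simp add: 1 algebra_simps)
    also have "\<dots> \<le> 2 * K * \<eta>"
      using e[of p q] e[of r s] by (simp add: K_def algebra_simps)
    finally show ?thesis using \<eta> by simp
  qed
  then show ?thesis using \<eta>(1) by blast
qed

lemma bact_neq_open:
  assumes "det F = 1" "bact F None \<noteq> \<eta>"
  shows "\<exists>\<rho>>0. \<forall>G. dist F G < \<rho> \<longrightarrow> det G = 1 \<longrightarrow> bact G None \<noteq> \<eta>"
proof -
  obtain K where K: "det K = 1" "bact K None = \<eta>"
    by (rule bdry_frame)
  let ?S = "{G :: real^2^2. G$1$1 * K$2$1 \<noteq> K$1$1 * G$2$1}"
  have "open ?S"
    by (intro open_Collect_neq continuous_intros)
  moreover have "F \<in> ?S"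
    using assms K bact_eq_iff[of F K] by simp
  ultimately obtain \<rho> where "0 < \<rho>" "ball F \<rho> \<subseteq> ?S"
    by (rule openE)
  then show ?thesis
    using bact_eq_iff[OF _ K(1)] K(2) by (intro exI[of _ \<rho>]) (auto simp: subset_iff)
qed

section \<open>The quotient by a Fuchsian group\<close>

locale fuchsian_group =
  fixes \<Gamma> :: "(real^2^2) set"
  assumes fuchsian: "fuchsian \<Gamma>"
begin

lemma det_Gamma: "A \<in> \<Gamma> \<Longrightarrow> det A = 1"
  using fuchsian by (auto simp: fuchsian_def)

lemma one_in_Gamma: "mat 1 \<in> \<Gamma>"
  using fuchsian by (auto simp: fuchsian_def)

lemma mult_in_Gamma: "A \<in> \<Gamma> \<Longrightarrow> B \<in> \<Gamma> \<Longrightarrow> A ** B \<in> \<Gamma>"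
  using fuchsian by (auto simp: fuchsian_def)

lemma sinv_in_Gamma: "A \<in> \<Gamma> \<Longrightarrow> sinv A \<in> \<Gamma>"
  using fuchsian matrix_inv_eq_sinv[OF det_Gamma, of A] by (auto simp: fuchsian_def)

lemma countable_Gamma: "countable \<Gamma>"
proof (rule countable_isolated)
  show "\<forall>A\<in>\<Gamma>. \<exists>e>0. \<forall>B\<in>\<Gamma>. dist A B < e \<longrightarrow> B = A"
    using fuchsian unfolding fuchsian_def by (elim conjE)
qed

text \<open>The preimage in \<open>SL(2, \<real>)\<close> of the image of \<open>\<Gamma>\<close> in \<open>PSL(2, \<real>)\<close>.\<close>
definition pm :: "(real^2^2) set" where
  "pm = \<Gamma> \<union> uminus ` \<Gamma>"

lemma pm_iff: "A \<in> pm \<longleftrightarrow> A \<in> \<Gamma> \<or> - A \<in> \<Gamma>"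
  by (force simp: pm_def)

lemma det_pm: "A \<in> pm \<Longrightarrow> det A = 1"
  using det_Gamma[of A] det_Gamma[of "- A"] by (auto simp: pm_iff det_2)

lemma mult_in_pm: "A \<in> pm \<Longrightarrow> B \<in> pm \<Longrightarrow> A ** B \<in> pm"
  using mult_in_Gamma[of A B] mult_in_Gamma[of "- A" B] mult_in_Gamma[of A "- B"] mult_in_Gamma[of "- A" "- B"]
  by (auto simp: pm_iff matrix_mult_minus_left matrix_mult_minus_right)

lemma sinv_in_pm: "A \<in> pm \<Longrightarrow> sinv A \<in> pm"
  using sinv_in_Gamma[of A] sinv_in_Gamma[of "- A"]
  by (cases A rule: mat22_cases) (auto simp: pm_iff)

lemma d1S_le:
  assumes "det F = 1" "det G = 1" "A \<in> pm"
  shows "d1S \<Gamma> (frame F) (frame G) \<le> d1 (frame F) (frame (A ** G))"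
proof -
  have *: "d1S \<Gamma> (frame F) (frame G) \<le> d1 (frame F) (frame (A ** G))" if "A \<in> \<Gamma>" for A
  proof -
    have "bdd_below ((\<lambda>A. d1 (frame F) (tact A (frame G))) ` \<Gamma>)"
      using assms by (intro bdd_belowI[of _ 0]) (auto simp: tact_frame det_Gamma d1_nonneg det_mult_1)
    then have "d1S \<Gamma> (frame F) (frame G) \<le> d1 (frame F) (tact A (frame G))"
      unfolding d1S_def using that by (rule cINF_lower)
    then show ?thesis
      using assms that by (simp add: tact_frame det_Gamma)
  qed
  from assms(3) have "A \<in> \<Gamma> \<or> - A \<in> \<Gamma>" by (simp add: pm_iff)
  then show ?thesis
    using *[of A] *[of "- A"] by (auto simp: matrix_mult_minus_left)
qed

lemma d1S_lessD:
  assumes "det F = 1" "det G = 1" "d1S \<Gamma> (frame F) (frame G) < r"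
  shows "\<exists>A\<in>\<Gamma>. d1 (frame F) (frame (A ** G)) < r"
  using cInf_lessD[of "(\<lambda>A. d1 (frame F) (tact A (frame G))) ` \<Gamma>" r] assms one_in_Gamma
  by (auto simp: d1S_def tact_frame det_Gamma)

lemma d1S_nonneg: "det F = 1 \<Longrightarrow> det G = 1 \<Longrightarrow> 0 \<le> d1S \<Gamma> (frame F) (frame G)"
  unfolding d1S_def using one_in_Gamma
  by (intro cINF_greatest) (auto simp: tact_frame det_Gamma d1_nonneg det_mult_1)

lemma d1S_triangle:
  assumes "det F = 1" "det G = 1" "det H = 1"
  shows "d1S \<Gamma> (frame F) (frame H) \<le> d1S \<Gamma> (frame F) (frame G) + d1S \<Gamma> (frame G) (frame H)"
proof (rule field_le_epsilon)
  fix e :: real assume "0 < e"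
  obtain A where A: "A \<in> \<Gamma>" "d1 (frame F) (frame (A ** G)) < d1S \<Gamma> (frame F) (frame G) + e / 2"
    using d1S_lessD[OF assms(1,2), of "d1S \<Gamma> (frame F) (frame G) + e / 2"] \<open>0 < e\<close> by auto
  obtain B where B: "B \<in> \<Gamma>" "d1 (frame G) (frame (B ** H)) < d1S \<Gamma> (frame G) (frame H) + e / 2"
    using d1S_lessD[OF assms(2,3), of "d1S \<Gamma> (frame G) (frame H) + e / 2"] \<open>0 < e\<close> by auto
  have det: "det A = 1" "det B = 1" using A B det_Gamma by auto
  have "d1S \<Gamma> (frame F) (frame H) \<le> d1 (frame F) (frame (A ** B ** H))"
    using A B assms by (intro d1S_le) (auto simp: pm_iff mult_in_Gamma)
  also have "\<dots> \<le> d1 (frame F) (frame (A ** G)) + d1 (frame (A ** G)) (frame (A ** B ** H))"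
    using assms det by (intro d1_triangle) (simp_all add: det_mult_1)
  also have "d1 (frame (A ** G)) (frame (A ** B ** H)) = d1 (frame G) (frame (B ** H))"
    using d1_left_invariant[of A G "B ** H"] assms det by (simp add: det_mult_1 matrix_mul_assoc)
  finally show "d1S \<Gamma> (frame F) (frame H) \<le> d1S \<Gamma> (frame F) (frame G) + d1S \<Gamma> (frame G) (frame H) + e"
    using A B by simp
qed

abbreviation flow_dist :: "real \<Rightarrow> real^2^2 \<Rightarrow> real^2^2 \<Rightarrow> real" where
  "flow_dist t F G \<equiv> d1S \<Gamma> (frame (F ** aflow t)) (frame (G ** aflow t))"

lemma flow_dist_triangle:
  assumes "det F = 1" "det G = 1" "det H = 1"
  shows "flow_dist t F H \<le> flow_dist t F G + flow_dist t G H"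
  using assms by (intro d1S_triangle) (simp_all add: det_mult_1)

text \<open>Left invariance reduces the claim to the distance from the identity to the conjugate in
  \<open>aflow_conj\<close>, whence the weights \<open>exp (- t)\<close> and \<open>exp t\<close>.
  As \<open>A\<close> is arbitrary in \<open>pm\<close>, different group elements may be used at
  different times.\<close>

lemma flow_dist_small:
  assumes "0 < \<epsilon>"
  shows "\<exists>\<eta>>0. \<forall>F G A t a b c d. det F = 1 \<longrightarrow> det G = 1 \<longrightarrow> A \<in> pm \<longrightarrow> A ** G = F ** mat22 a b c d \<longrightarrow>
    \<bar>a - d\<bar> \<le> \<eta> \<longrightarrow> \<bar>b\<bar> * exp (- t) \<le> \<eta> \<longrightarrow> \<bar>c\<bar> * exp t \<le> \<eta> \<longrightarrow> flow_dist t F G \<le> \<epsilon>"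
proof -
  obtain \<eta> where \<eta>: "0 < \<eta>" "\<And>a b c d. a * d - b * c = 1 \<Longrightarrow> \<bar>a - d\<bar> \<le> \<eta> \<Longrightarrow> \<bar>b\<bar> \<le> \<eta> \<Longrightarrow> \<bar>c\<bar> \<le> \<eta> \<Longrightarrow>
    d1 (frame (mat 1)) (frame (mat22 a b c d)) \<le> \<epsilon>"
    using d1_identity_small[OF assms] by metis
  show ?thesis
  proof (intro exI[of _ \<eta>] conjI allI impI)
    fix F G A :: "real^2^2" and t a b c d :: real
    assume F: "det F = 1" and G: "det G = 1" and A: "A \<in> pm" and eq: "A ** G = F ** mat22 a b c d"
      and s: "\<bar>a - d\<bar> \<le> \<eta>" "\<bar>b\<bar> * exp (- t) \<le> \<eta>" "\<bar>c\<bar> * exp t \<le> \<eta>"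
    have "det (F ** mat22 a b c d) = 1"
      using eq A G det_pm by (metis det_mult_1)
    then have det: "a * d - b * c = 1"
      using F by (simp add: det_mul)
    have "flow_dist t F G \<le> d1 (frame (F ** aflow t)) (frame (A ** (G ** aflow t)))"
      using F G A by (intro d1S_le) (simp_all add: det_mult_1)
    also have "A ** (G ** aflow t) = F ** mat22 a b c d ** aflow t"
      by (simp add: matrix_mul_assoc eq)
    also have "\<dots> = (F ** aflow t) ** (aflow (- t) ** mat22 a b c d ** aflow t)"
      using sinv_cancel(2)[OF det_aflow, of t "mat22 a b c d ** aflow t"]
      by (simp only: aflow_inverse matrix_mul_assoc[symmetric])
    also have "d1 (frame (F ** aflow t)) (frame \<dots>) = d1 (frame ((F ** aflow t) ** mat 1)) (frame \<dots>)"
      by simp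
    also have "\<dots> = d1 (frame (mat 1)) (frame (aflow (- t) ** mat22 a b c d ** aflow t))"
      using F det by (intro d1_left_invariant) (simp_all add: det_mult_1)
    also have "\<dots> \<le> \<epsilon>"
    proof -
      have "c * (b * (exp t * exp (- t))) = c * b"
        by (simp flip: exp_add)
      then show ?thesis
        using s det unfolding aflow_conj by (intro \<eta>(2)) (simp_all add: abs_mult algebra_simps)
    qed
    finally show "flow_dist t F G \<le> \<epsilon>" .
  qed (use \<eta> in simp)
qed

lemma flow_dist_up_tendsto:
  assumes "det F = 1"
  shows "((\<lambda>t. flow_dist t F (F ** up s)) \<longlongrightarrow> 0) at_top"
proof (rule tendstoI)
  fix e :: real assume "0 < e"
  obtain \<eta> where \<eta>: "0 < \<eta>" "\<And>F G A t a b c d. \<lbrakk>det F = 1; det G = 1; A \<in> pm; A ** G = F ** mat22 a b c d;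
    \<bar>a - d\<bar> \<le> \<eta>; \<bar>b\<bar> * exp (- t) \<le> \<eta>; \<bar>c\<bar> * exp t \<le> \<eta>\<rbrakk> \<Longrightarrow> flow_dist t F G \<le> e / 2"
    using flow_dist_small[of "e / 2"] \<open>0 < e\<close> by (metis half_gt_zero)
  have "((\<lambda>t. \<bar>s\<bar> * inverse (exp t)) \<longlongrightarrow> \<bar>s\<bar> * 0) at_top"
    by (intro tendsto_intros tendsto_inverse_0_at_top exp_at_top)
  then have "\<forall>\<^sub>F t in at_top. \<bar>s\<bar> * inverse (exp t) < \<eta>"
    using \<eta>(1) by (intro order_tendstoD) auto
  then show "\<forall>\<^sub>F t in at_top. dist (flow_dist t F (F ** up s)) 0 < e"
  proof eventually_elim
    case (elim t)
    have "flow_dist t F (F ** up s) \<le> e / 2"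
      using assms elim \<eta>(1)
      by (intro \<eta>(2)[where A = "mat 1" and a = 1 and b = s and c = 0 and d = 1])
        (simp_all add: pm_iff one_in_Gamma det_mult_1 up_def[symmetric] exp_minus)
    then show ?case
      using d1S_nonneg[of "F ** aflow t" "F ** up s ** aflow t"] assms \<open>0 < e\<close> by (simp add: det_mult_1)
  qed
qed

lemma flow_dist_pm_self:
  assumes "det H = 1" "A \<in> pm"
  shows "flow_dist t H (A ** H) \<le> 0"
proof -
  have "flow_dist t H (A ** H) \<le> d1 (frame (H ** aflow t)) (frame (sinv A ** (A ** H ** aflow t)))"
    using assms by (intro d1S_le) (simp_all add: det_mult_1 det_pm sinv_in_pm)
  also have "sinv A ** (A ** H ** aflow t) = H ** aflow t"
    using assms det_pm sinv_cancel(1)[of A "H ** aflow t"] by (simp add: matrix_mul_assoc)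
  finally show ?thesis by simp
qed

section \<open>Shadowing a cusp-recurrent geodesic\<close>

text \<open>The geodesic meets a translate by \<open>B\<close> of a horocycle on which a parabolic
  \<open>A\<close> moves points little; the conjugate \<open>B ** A ** sinv B\<close> does the same
  on the translate.\<close>

lemma cusp_recurrent_displacement:
  assumes U: "det U = 1" and cusp: "cusp_recurrent \<Gamma> (frame U)" and "0 < \<epsilon>"
  shows "\<exists>P\<in>\<Gamma>. \<exists>t\<ge>0. parabolic P \<and> hdist (mob (U ** aflow t) \<i>) (mob P (mob (U ** aflow t) \<i>)) < \<epsilon>"
proof -
  obtain \<xi> z t where *: "\<forall>n::nat. parabolic_fixed \<Gamma> (\<xi> n) \<and> z n \<in> HH \<and> t n \<ge> 0 \<and>
                 (\<exists>A\<in>\<Gamma>. geod (frame U) (t n) \<in> mob A ` horocycle (\<xi> n) (z n))"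
      and lim: "(\<lambda>n. closed_horo_length \<Gamma> (\<xi> n) (z n)) \<longlonglongrightarrow> 0"
    using cusp unfolding cusp_recurrent_def by (elim conjE exE)
  have "\<forall>\<^sub>F n in sequentially. closed_horo_length \<Gamma> (\<xi> n) (z n) < \<epsilon>"
    using lim \<open>0 < \<epsilon>\<close> by (rule order_tendstoD(2))
  then obtain n where n: "closed_horo_length \<Gamma> (\<xi> n) (z n) < \<epsilon>"
    using eventually_happens'[OF sequentially_bot] by blast
  obtain A where A: "A \<in> \<Gamma>" "parabolic A" "\<And>y. y \<in> horocycle (\<xi> n) (z n) \<Longrightarrow> hdist y (mob A y) < \<epsilon>"
    using closed_horo_length_less_imp[OF det_Gamma _ _ n] * by auto
  obtain B y where B: "B \<in> \<Gamma>" "y \<in> horocycle (\<xi> n) (z n)" "geod (frame U) (t n) = mob B y"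
    using * by blast
  have y: "0 < Im y" using B(2) by (simp add: horocycle_def)
  have det: "det A = 1" "det B = 1" using A B det_Gamma by auto
  have By: "mob (U ** aflow (t n)) \<i> = mob B y"
    using B(3) U by (simp add: geod_frame mob_mult)
  have "mob (B ** A ** sinv B) (mob B y) = mob B (mob A y)"
    using det y by (simp add: mob_mult mob_in_HH mob_sinv det_mult_1)
  then have "hdist (mob B y) (mob (B ** A ** sinv B) (mob B y)) = hdist y (mob A y)"
    using det y by (simp add: hdist_mob mob_in_HH)
  then have "hdist (mob B y) (mob (B ** A ** sinv B) (mob B y)) < \<epsilon>"
    using A(3) B(2) by simp
  moreover have "B ** A ** sinv B \<in> \<Gamma>"
    using A B by (intro mult_in_Gamma sinv_in_Gamma)
  ultimately show ?thesis
    using * parabolic_conj[OF A(2) det(2)] By by metis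
qed

lemma cusp_recurrent_elements:
  assumes U: "det U = 1" and cusp: "cusp_recurrent \<Gamma> (frame U)" and \<delta>: "0 < \<delta>"
  shows "\<exists>P\<in>pm. \<exists>t\<ge>0. \<exists>a b c d. P ** U = U ** mat22 a (b * exp t) (c * exp (- t)) d \<and> c \<noteq> 0 \<and>
    \<bar>a - 1\<bar> \<le> \<delta> \<and> \<bar>d - 1\<bar> \<le> \<delta> \<and> \<bar>b\<bar> \<le> \<delta> \<and> \<bar>c\<bar> \<le> \<delta>"
proof -
  \<comment> \<open>Chosen so that \<open>cosh \<epsilon>\<close> matches the expression in
    \<open>cosh_hdist_mob_i\<close>.\<close>
  define \<epsilon> where "\<epsilon> = arcosh (1 + \<delta>\<^sup>2 / 2)"
  have "0 < \<epsilon>" using \<delta> by (simp add: \<epsilon>_def)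
  obtain P t where P: "P \<in> \<Gamma>" "0 \<le> t" "parabolic P"
      "hdist (mob (U ** aflow t) \<i>) (mob P (mob (U ** aflow t) \<i>)) < \<epsilon>"
    using cusp_recurrent_displacement[OF U cusp \<open>0 < \<epsilon>\<close>] by (elim bexE exE conjE)
  define F where "F = U ** aflow t"
  have det: "det P = 1" "det F = 1" using P U by (simp_all add: F_def det_Gamma det_mult_1)
  define Q where "Q = sinv F ** P ** F"
  have detQ: "det Q = 1" using det by (simp add: Q_def det_mult_1)
  obtain a b c d where Q: "Q = mat22 a b c d" by (rule mat22_cases)
  have ad: "a * d - b * c = 1" using detQ Q by simp
  have "Q$1$1 + Q$2$2 = (P$1$1 + P$2$2) * det F"
    unfolding Q_def by (cases P rule: mat22_cases, cases F rule: mat22_cases) (simp add: algebra_simps)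
  then have tr: "\<bar>a + d\<bar> = 2" using P(3) det Q by (simp add: parabolic_def)
  have "hdist \<i> (mob Q \<i>) < \<epsilon>"
    using P(4) hdist_mob_conj[OF det] by (simp add: F_def Q_def)
  then have "cosh (hdist \<i> (mob Q \<i>)) < cosh \<epsilon>"
    using hdist_nonneg[of \<i> "mob Q \<i>"] mob_in_HH[OF detQ, of \<i>] by (intro cosh_real_strict_mono) simp_all
  also have "cosh \<epsilon> = 1 + \<delta>\<^sup>2 / 2" by (simp add: \<epsilon>_def)
  finally have sq: "(a - d)\<^sup>2 + (b + c)\<^sup>2 \<le> \<delta>\<^sup>2"
    using cosh_hdist_mob_i[OF detQ] by (simp add: Q)
  have "P ** F = F ** Q"
    using sinv_cancel(2)[OF det(2), of "P ** F"] by (simp add: Q_def matrix_mul_assoc)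
  then have "P ** U ** aflow t ** aflow (- t) = U ** (aflow (- (- t)) ** Q ** aflow (- t))"
    by (simp add: F_def matrix_mul_assoc)
  moreover have "P ** U ** aflow t ** aflow (- t) = P ** U"
    using sinv_right[OF det_aflow, of t] by (simp add: aflow_inverse flip: matrix_mul_assoc)
  ultimately have PU: "P ** U = U ** mat22 a (b * exp t) (c * exp (- t)) d"
    unfolding Q aflow_conj by simp
  \<comment> \<open>If \<open>c\<close> vanished, \<open>P\<close> would fix the endpoint of
    \<open>u\<close>, which is not a parabolic fixed point.\<close>
  have c0: "c \<noteq> 0"
  proof
    assume "c = 0"
    then have "(P ** U)$1$1 * U$2$1 = U$1$1 * (P ** U)$2$1"
      unfolding PU by (cases U rule: mat22_cases) simp
    then have "bact P (bact U None) = bact U None"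
      using U det by (simp add: bact_mult bact_eq_iff det_mult_1)
    then have "parabolic_fixed \<Gamma> (vplus (frame U))"
      using P U by (auto simp: parabolic_fixed_def vplus_frame)
    then show False using cusp by (simp add: cusp_recurrent_def)
  qed
  \<comment> \<open>In the case of trace -2 the matrix near the identity is \<open>- P\<close>; this
    is why the conclusion speaks of \<open>pm\<close>.\<close>
  from tr have "a + d = 2 \<or> (- a) + (- d) = 2" by linarith
  then show ?thesis
  proof
    assume "a + d = 2"
    from near_identity_if_trace_2[OF ad this sq] show ?thesis
      using P PU c0 \<delta> by (intro bexI[of _ P] exI[of _ t] conjI exI[of _ a] exI[of _ b] exI[of _ c] exI[of _ d])
        (simp_all add: pm_iff)
  next
    assume tr': "(- a) + (- d) = 2"
    have "(- a) * (- d) - (- b) * (- c) = 1" using ad by simp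
    moreover have "(- a - - d)\<^sup>2 + (- b + - c)\<^sup>2 \<le> \<delta>\<^sup>2"
      using sq by (simp add: power2_eq_square algebra_simps)
    ultimately have near: "\<bar>- a - 1\<bar> \<le> \<delta> \<and> \<bar>- d - 1\<bar> \<le> \<delta> \<and> \<bar>- b\<bar> \<le> \<delta> \<and> \<bar>- c\<bar> \<le> \<delta>"
      using near_identity_if_trace_2 tr' \<delta> by (metis less_imp_le)
    have "(- P) ** U = U ** mat22 (- a) (- b * exp t) (- c * exp (- t)) (- d)"
      using PU matrix_mult_minus_right[of U "mat22 a (b * exp t) (c * exp (- t)) d"] by (simp add: matrix_mult_minus_left)
    then show ?thesis
      using P near c0 by (intro bexI[of _ "- P"] exI[of _ t] conjI exI[of _ "- a"] exI[of _ "- b"] exI[of _ "- c"] exI[of _ "- d"])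
        (simp_all add: pm_iff)
  qed
qed

text \<open>Lifts of the vectors in the stable horocycle of \<open>u\<close> in the quotient. Each
  perturbation stays in this class; a limit of perturbations may leave it.\<close>

definition follows :: "real^2^2 \<Rightarrow> real^2^2 \<Rightarrow> bool" where
  "follows U F \<longleftrightarrow> (\<exists>A\<in>pm. \<exists>s. F = A ** U ** up s)"

lemma det_follows: "follows U F \<Longrightarrow> det U = 1 \<Longrightarrow> det F = 1"
  by (auto simp: follows_def det_mult_1 det_pm)

text \<open>If \<open>P\<close> displaces the point of \<open>u\<close> at time \<open>t\<^sub>0\<close> only a little, a vector that shadows \<open>F\<close> up to
  \<open>t\<^sub>0\<close> and its image under \<open>P\<close> afterwards stays close to \<open>F\<close> in the quotient for all times.\<close>
lemma follows_perturb:
  assumes U: "det U = 1" and cusp: "cusp_recurrent \<Gamma> (frame U)" and F: "follows U F" and "0 < \<epsilon>"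
  shows "\<exists>F'. follows U F' \<and> dist F F' < \<epsilon> \<and> (\<forall>t\<ge>0. flow_dist t F F' \<le> \<epsilon>) \<and> bact F' None \<noteq> bact F None"
proof -
  obtain A s where A: "A \<in> pm" "F = A ** U ** up s"
    using F by (auto simp: follows_def)
  have detF: "det F = 1" using F U by (rule det_follows)
  obtain \<eta>\<^sub>1 where \<eta>\<^sub>1: "0 < \<eta>\<^sub>1" "\<And>F G A t a b c d. \<lbrakk>det F = 1; det G = 1; A \<in> pm; A ** G = F ** mat22 a b c d;
    \<bar>a - d\<bar> \<le> \<eta>\<^sub>1; \<bar>b\<bar> * exp (- t) \<le> \<eta>\<^sub>1; \<bar>c\<bar> * exp t \<le> \<eta>\<^sub>1\<rbrakk> \<Longrightarrow> flow_dist t F G \<le> \<epsilon>"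
    using flow_dist_small[OF \<open>0 < \<epsilon>\<close>] by metis
  obtain \<eta>\<^sub>2 where \<eta>\<^sub>2: "0 < \<eta>\<^sub>2" "\<And>a b c d. \<lbrakk>\<bar>a - 1\<bar> \<le> \<eta>\<^sub>2; \<bar>b\<bar> \<le> \<eta>\<^sub>2; \<bar>c\<bar> \<le> \<eta>\<^sub>2; \<bar>d - 1\<bar> \<le> \<eta>\<^sub>2\<rbrakk> \<Longrightarrow>
    dist F (F ** mat22 a b c d) < \<epsilon>"
    using dist_mult_near_identity[OF \<open>0 < \<epsilon>\<close>] by metis
  define \<eta> where "\<eta> = min (\<eta>\<^sub>1 / 2) \<eta>\<^sub>2"
  \<comment> \<open>\<open>k * \<delta>\<close> dominates all entry errors below; conjugation by
    \<open>up s\<close> produces terms of degree up to 2 in \<open>s\<close>. The bound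
    \<open>1 / 2\<close> on \<open>\<delta>\<close> keeps \<open>a\<close> away from 0.\<close>
  define k where "k = 5 + 5 * \<bar>s\<bar> + s\<^sup>2"
  define \<delta> where "\<delta> = min (1 / 2) (\<eta> / k)"
  have k: "5 \<le> k" by (simp add: k_def)
  have \<eta>: "0 < \<eta>" "2 * \<eta> \<le> \<eta>\<^sub>1" "\<eta> \<le> \<eta>\<^sub>2" using \<eta>\<^sub>1(1) \<eta>\<^sub>2(1) by (auto simp: \<eta>_def)
  have \<delta>: "0 < \<delta>" "\<delta> \<le> 1 / 2"
    using \<eta> k min.cobounded1[of "1 / 2" "\<eta> / k"] by (simp_all only: \<delta>_def) simp
  have k\<delta>: "k * \<delta> \<le> \<eta>"
  proof -
    have "\<delta> \<le> \<eta> / k" by (simp add: \<delta>_def)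
    then show ?thesis using k by (simp add: field_simps)
  qed
  obtain P t\<^sub>0 a b c d where P: "P \<in> pm" "0 \<le> t\<^sub>0" "P ** U = U ** mat22 a (b * exp t\<^sub>0) (c * exp (- t\<^sub>0)) d" "c \<noteq> 0"
      "\<bar>a - 1\<bar> \<le> \<delta>" "\<bar>d - 1\<bar> \<le> \<delta>" "\<bar>b\<bar> \<le> \<delta>" "\<bar>c\<bar> \<le> \<delta>"
    using cusp_recurrent_elements[OF U cusp \<delta>(1)] by (elim bexE exE conjE)
  have a: "1 / 2 \<le> a" "a \<le> 3 / 2" using P(5) \<delta>(2) by linarith+
  define B where "B = b * exp t\<^sub>0"
  define C where "C = c * exp (- t\<^sub>0)"
  have PU: "P ** U = U ** mat22 a B C d" using P(3) by (simp add: B_def C_def)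
  have "det (P ** U) = 1" using P(1) U by (simp add: det_mult_1 det_pm)
  then have "det (mat22 a B C d) = 1" using U by (simp add: PU det_mul)
  then have d: "d = (1 + B * C) / a" using a by (simp add: field_simps)
  have C: "\<bar>C\<bar> \<le> \<delta>" "C \<noteq> 0"
  proof -
    have "\<bar>c\<bar> * exp (- t\<^sub>0) \<le> \<delta> * 1"
      using P \<delta> by (intro mult_mono) auto
    then show "\<bar>C\<bar> \<le> \<delta>" by (simp add: C_def abs_mult)
  qed (use P in \<open>simp add: C_def\<close>)
  \<comment> \<open>The shift by \<open>- B / a\<close> turns \<open>mat22 a B C d\<close> into the
    lower triangular \<open>mat22 a 0 C (1 / a)\<close>; \<open>M\<close> is the conjugate of the
    latter by \<open>up s\<close>.\<close>
  define s' where "s' = s - B / a"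
  define F' where "F' = A ** P ** U ** up s'"
  define M where "M = mat22 (a - s * C) (s * a - s * (s * C + 1 / a)) C (s * C + 1 / a)"
  have F': "F' = F ** M"
  proof -
    have eq: "mat22 a B C d ** up s' = up s ** M"
      using a by (simp add: up_def M_def s'_def d field_simps)
    have "F' = A ** (P ** U) ** up s'"
      by (simp only: F'_def matrix_mul_assoc)
    also have "\<dots> = A ** (U ** (mat22 a B C d ** up s'))"
      by (simp only: PU matrix_mul_assoc)
    also have "\<dots> = F ** M"
      by (simp only: eq A(2) matrix_mul_assoc)
    finally show ?thesis .
  qed
  have fol: "follows U F'"
    unfolding follows_def F'_def
    by (intro bexI[of _ "A ** P"] exI[of _ s'] mult_in_pm A P refl)
  have detF': "det F' = 1" using fol U by (rule det_follows)
  have inv: "\<bar>1 / a - 1\<bar> \<le> 2 * \<delta>"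
  proof -
    have "1 / a - 1 = - (a - 1) / a"
      using a by (simp add: diff_divide_distrib)
    then have "\<bar>1 / a - 1\<bar> = \<bar>a - 1\<bar> / a"
      using a by (simp add: abs_divide)
    also have "\<dots> \<le> \<delta> / (1 / 2)"
      using a P(5) by (intro frac_le) auto
    finally show ?thesis by simp
  qed
  have sC: "\<bar>s * C\<bar> \<le> \<bar>s\<bar> * \<delta>"
    unfolding abs_mult by (intro mult_left_mono C) simp_all
  have ssC: "\<bar>s * (s * C)\<bar> \<le> s\<^sup>2 * \<delta>"
  proof -
    have "\<bar>s * (s * C)\<bar> = s\<^sup>2 * \<bar>C\<bar>"
      by (simp add: abs_mult power2_eq_square)
    then show ?thesis using mult_left_mono[OF C(1), of "s\<^sup>2"] by simp
  qed
  have sa: "\<bar>s * (a - 1 / a)\<bar> \<le> \<bar>s\<bar> * (3 * \<delta>)"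
  proof -
    have "\<bar>a - 1 / a\<bar> \<le> 3 * \<delta>" using inv P(5) by linarith
    then show ?thesis unfolding abs_mult by (intro mult_left_mono) simp_all
  qed
  have k_split: "k * \<delta> = 5 * \<delta> + 5 * (\<bar>s\<bar> * \<delta>) + s\<^sup>2 * \<delta>"
    by (simp add: k_def algebra_simps)
  have pos: "0 \<le> \<bar>s\<bar> * \<delta>" "0 \<le> s\<^sup>2 * \<delta>" using \<delta> by simp_all
  have m11: "\<bar>(a - s * C) - 1\<bar> \<le> \<eta>"
    using sC P(5) k\<delta> k_split pos \<delta> by linarith
  have m22: "\<bar>(s * C + 1 / a) - 1\<bar> \<le> \<eta>"
    using sC inv k\<delta> k_split pos \<delta> by linarith
  have m12: "\<bar>s * a - s * (s * C + 1 / a)\<bar> \<le> \<eta>"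
  proof -
    have "s * a - s * (s * C + 1 / a) = s * (a - 1 / a) - s * (s * C)"
      by (simp add: algebra_simps)
    then show ?thesis
      using sa ssC k\<delta> k_split pos \<delta> by linarith
  qed
  have m21: "\<bar>C\<bar> \<le> \<eta>" using C k\<delta> k_split pos \<delta> by linarith
  have "dist F F' < \<epsilon>"
    unfolding F' M_def using m11 m12 m21 m22 \<eta> by (intro \<eta>\<^sub>2(2)) auto
  moreover have "flow_dist t F F' \<le> \<epsilon>" if "0 \<le> t" for t
  proof (cases "t \<le> t\<^sub>0")
    case True
    \<comment> \<open>Until \<open>t\<^sub>0\<close> the comparison uses the identity: the expanding
      entry satisfies \<open>\<bar>C\<bar> * exp t \<le> \<bar>c\<bar>\<close>.\<close>
    show ?thesis
    proof (rule \<eta>\<^sub>1(2)[OF detF detF'])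
      show "mat 1 \<in> pm" by (simp add: pm_iff one_in_Gamma)
      show "mat 1 ** F' = F ** mat22 (a - s * C) (s * a - s * (s * C + 1 / a)) C (s * C + 1 / a)"
        by (simp add: F' M_def)
      show "\<bar>(a - s * C) - (s * C + 1 / a)\<bar> \<le> \<eta>\<^sub>1"
        using m11 m22 \<eta> by linarith
      have "\<bar>s * a - s * (s * C + 1 / a)\<bar> * exp (- t) \<le> \<eta> * 1"
        using m12 \<eta> \<open>0 \<le> t\<close> by (intro mult_mono) auto
      then show "\<bar>s * a - s * (s * C + 1 / a)\<bar> * exp (- t) \<le> \<eta>\<^sub>1" using \<eta> by simp
      have "\<bar>C\<bar> * exp t = \<bar>c\<bar> * exp (t - t\<^sub>0)"
        by (simp add: C_def abs_mult exp_diff exp_minus field_simps)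
      also have "\<dots> \<le> \<delta> * 1"
        using P \<delta> True by (intro mult_mono) auto
      also have "\<dots> \<le> \<eta>\<^sub>1"
        using k\<delta> k_split pos \<delta> \<eta> by linarith
      finally show "\<bar>C\<bar> * exp t \<le> \<eta>\<^sub>1" .
    qed
  next
    case False
    \<comment> \<open>From \<open>t\<^sub>0\<close> on the comparison undoes \<open>P\<close>. Only
      the unipotent factor with entry \<open>- B / a\<close> remains, and the flow has already
      contracted it to size at most \<open>\<bar>b\<bar> / a\<close>.\<close>
    show ?thesis
    proof (rule \<eta>\<^sub>1(2)[OF detF detF'])
      show "A ** sinv P ** sinv A \<in> pm"
        using A P by (intro mult_in_pm sinv_in_pm)
      have "up s' = up s ** up (- B / a)"
        by (simp add: up_def s'_def)
      moreover have "A ** sinv P ** sinv A ** (A ** P ** U ** up s') = A ** U ** up s'"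
      proof -
        have "A ** sinv P ** sinv A ** (A ** P ** U ** up s') = A ** (U ** up s')"
          by (simp only: matrix_mul_assoc[symmetric] sinv_cancel[OF det_pm[OF A(1)]] sinv_cancel[OF det_pm[OF P(1)]])
        then show ?thesis
          by (simp only: matrix_mul_assoc)
      qed
      ultimately show "A ** sinv P ** sinv A ** F' = F ** mat22 1 (- B / a) 0 1"
        unfolding F'_def A(2) by (simp only: matrix_mul_assoc up_def)
      have "\<bar>- B / a\<bar> * exp (- t) = \<bar>b\<bar> * exp (t\<^sub>0 - t) / a"
        using a by (simp add: B_def abs_mult exp_diff exp_minus field_simps)
      also have "\<dots> \<le> (\<delta> * 1) / (1 / 2)"
        using P \<delta> False a by (intro frac_le mult_mono) auto
      also have "\<dots> = 2 * \<delta>" by simp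
      also have "\<dots> \<le> \<eta>\<^sub>1"
        using k\<delta> k_split pos \<delta> \<eta> by linarith
      finally show "\<bar>- B / a\<bar> * exp (- t) \<le> \<eta>\<^sub>1" .
    qed (use \<eta>\<^sub>1(1) in simp_all)
  qed
  moreover have "bact F' None \<noteq> bact F None"
  proof
    assume "bact F' None = bact F None"
    then have "F'$1$1 * F$2$1 = F$1$1 * F'$2$1"
      using bact_eq_iff[OF detF' detF] by simp
    \<comment> \<open>The first columns of \<open>F\<close> and \<open>F ** M\<close> span the
      determinant \<open>C * det F\<close>.\<close>
    then have "C * det F = 0"
      unfolding F' M_def by (cases F rule: mat22_cases) (auto simp: algebra_simps)
    then show False using C(2) detF by simp
  qed
  ultimately show ?thesis using fol by blast
qed

section \<open>The strong stable set and limits of frames\<close>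

lemma flow_dist_follows_tendsto:
  assumes U: "det U = 1" and F: "follows U F"
  shows "((\<lambda>t. flow_dist t U F) \<longlongrightarrow> 0) at_top"
proof -
  obtain A s where A: "A \<in> pm" "F = A ** (U ** up s)"
    using F by (auto simp: follows_def matrix_mul_assoc)
  have det: "det F = 1" "det (U ** up s) = 1"
    using det_follows[OF F U] U by (simp_all add: det_mult_1)
  have "flow_dist t U F \<le> flow_dist t U (U ** up s)" for t
    using flow_dist_triangle[OF U det(2,1), of t] flow_dist_pm_self[OF det(2) A(1), of t] A(2) by simp
  moreover have "0 \<le> flow_dist t U F" for t
    using U det by (intro d1S_nonneg) (simp_all add: det_mult_1)
  ultimately show ?thesis
    by (intro tendsto_sandwich[OF _ _ tendsto_const flow_dist_up_tendsto[OF U, of s]]) auto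
qed

text \<open>At a fixed time, \<open>sinv (F n) ** G\<close> tends to the identity. Convergence for
  each single \<open>t\<close> is enough, since uniformity comes from the bounds on successive
  perturbations.\<close>

lemma flow_dist_tendsto:
  assumes F: "\<And>n. det (F n) = 1" and G: "det G = 1" and lim: "F \<longlonglongrightarrow> G"
  shows "(\<lambda>n. flow_dist t (F n) G) \<longlonglongrightarrow> 0"
proof (rule tendstoI)
  fix e :: real assume "0 < e"
  obtain \<eta> where \<eta>: "0 < \<eta>" "\<And>F G A t a b c d. \<lbrakk>det F = 1; det G = 1; A \<in> pm; A ** G = F ** mat22 a b c d;
    \<bar>a - d\<bar> \<le> \<eta>; \<bar>b\<bar> * exp (- t) \<le> \<eta>; \<bar>c\<bar> * exp t \<le> \<eta>\<rbrakk> \<Longrightarrow> flow_dist t F G \<le> e / 2"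
    using flow_dist_small[of "e / 2"] \<open>0 < e\<close> by (metis half_gt_zero)
  define M where "M n = sinv (F n) ** G" for n
  have lim': "(\<lambda>n. F n $ i $ j) \<longlonglongrightarrow> G $ i $ j" for i j
    by (intro tendsto_vec_nth lim)
  have M: "M n = mat22 (F n$2$2 * G$1$1 - F n$1$2 * G$2$1) (F n$2$2 * G$1$2 - F n$1$2 * G$2$2)
      (F n$1$1 * G$2$1 - F n$2$1 * G$1$1) (F n$1$1 * G$2$2 - F n$2$1 * G$1$2)" (is "_ = mat22 (?a n) (?b n) (?c n) (?d n)") for n
    unfolding M_def sinv_def by (cases G rule: mat22_cases) simp
  have g: "G$2$2 * G$1$1 - G$1$2 * G$2$1 = 1" "G$1$1 * G$2$2 - G$2$1 * G$1$2 = 1"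
    using G by (simp_all add: det_2 mult.commute)
  have "(\<lambda>n. \<bar>?a n - ?d n\<bar>) \<longlonglongrightarrow> \<bar>(G$2$2 * G$1$1 - G$1$2 * G$2$1) - (G$1$1 * G$2$2 - G$2$1 * G$1$2)\<bar>"
    by (intro tendsto_intros lim')
  then have 1: "\<forall>\<^sub>F n in sequentially. \<bar>?a n - ?d n\<bar> < \<eta>"
    using \<eta>(1) unfolding g by (intro order_tendstoD(2)) auto
  have "(\<lambda>n. \<bar>?b n\<bar> * exp (- t)) \<longlonglongrightarrow> \<bar>G$2$2 * G$1$2 - G$1$2 * G$2$2\<bar> * exp (- t)"
    by (intro tendsto_intros lim')
  then have 2: "\<forall>\<^sub>F n in sequentially. \<bar>?b n\<bar> * exp (- t) < \<eta>"
    using \<eta>(1) by (intro order_tendstoD(2)) (auto simp: mult.commute)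
  have "(\<lambda>n. \<bar>?c n\<bar> * exp t) \<longlonglongrightarrow> \<bar>G$1$1 * G$2$1 - G$2$1 * G$1$1\<bar> * exp t"
    by (intro tendsto_intros lim')
  then have 3: "\<forall>\<^sub>F n in sequentially. \<bar>?c n\<bar> * exp t < \<eta>"
    using \<eta>(1) by (intro order_tendstoD(2)) (auto simp: mult.commute)
  show "\<forall>\<^sub>F n in sequentially. dist (flow_dist t (F n) G) 0 < e"
    using 1 2 3
  proof eventually_elim
    case (elim n)
    have "flow_dist t (F n) G \<le> e / 2"
    proof (rule \<eta>(2)[OF F G])
      show "mat 1 \<in> pm" by (simp add: pm_iff one_in_Gamma)
      show "mat 1 ** G = F n ** mat22 (?a n) (?b n) (?c n) (?d n)"
        unfolding M[symmetric] M_def by (simp add: sinv_cancel F)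
    qed (use elim in simp_all)
    moreover have "0 \<le> flow_dist t (F n) G"
      using F G by (intro d1S_nonneg) (simp_all add: det_mult_1)
    ultimately show ?case using \<open>0 < e\<close> by simp
  qed
qed

text \<open>Lifts of the strong stable set; endpoints make sense for lifts only.\<close>

definition shadowing_vectors :: "real^2^2 \<Rightarrow> (complex \<times> complex) set" where
  "shadowing_vectors U = {v \<in> T1H. ((\<lambda>t. d1S \<Gamma> (gflow t (frame U)) (gflow t v)) \<longlongrightarrow> 0) at_top}"

lemma frame_shadowing_iff:
  assumes "det U = 1" "det F = 1"
  shows "frame F \<in> shadowing_vectors U \<longleftrightarrow> ((\<lambda>t. flow_dist t U F) \<longlongrightarrow> 0) at_top"
  using assms by (simp add: shadowing_vectors_def frame_in_T1H gflow_frame)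

text \<open>If the endpoint of \<open>F\<close> is already different from \<open>\<eta>\<close>, the
  frame is kept; otherwise any perturbation that moves the endpoint will do. By openness a small
  ball around the result avoids \<open>\<eta>\<close> as well.\<close>

lemma refine_avoiding:
  assumes U: "det U = 1" and cusp: "cusp_recurrent \<Gamma> (frame U)" and F: "follows U F" and r: "0 < r" and e: "0 < e"
  shows "\<exists>F' r'. follows U F' \<and> 0 < r' \<and> r' \<le> e \<and> cball F' r' \<subseteq> cball F r \<and> (\<forall>t\<ge>0. flow_dist t F F' \<le> e) \<and>
    (\<forall>G\<in>cball F' r'. det G = 1 \<longrightarrow> bact G None \<noteq> \<eta>)"
proof -
  have detF: "det F = 1" using F U by (rule det_follows)
  obtain F' where F': "follows U F'" "dist F F' \<le> r / 2" "\<forall>t\<ge>0. flow_dist t F F' \<le> e" "bact F' None \<noteq> \<eta>"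
  proof (cases "bact F None = \<eta>")
    case True
    have "0 < min (r / 2) e" using r e by simp
    from follows_perturb[OF U cusp F this] obtain F' where
      "follows U F'" "dist F F' < min (r / 2) e" "\<forall>t\<ge>0. flow_dist t F F' \<le> min (r / 2) e" "bact F' None \<noteq> bact F None"
      by (elim exE conjE)
    then show ?thesis using True by (intro that[of F']) auto
  next
    case False
    have "flow_dist t F F \<le> 0" for t
      using flow_dist_pm_self[OF detF, of "mat 1" t] by (simp add: pm_iff one_in_Gamma)
    then have "\<forall>t\<ge>0. flow_dist t F F \<le> e"
      using e by (meson less_imp_le order_trans)
    then show ?thesis using False F r by (intro that[of F]) auto
  qed
  have "det F' = 1" using F'(1) U by (rule det_follows)
  from bact_neq_open[OF this F'(4)] obtain \<rho> where \<rho>: "0 < \<rho>"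
      "\<forall>G. dist F' G < \<rho> \<longrightarrow> det G = 1 \<longrightarrow> bact G None \<noteq> \<eta>"
    by (elim exE conjE)
  define r' where "r' = min (min (r / 2) (\<rho> / 2)) e"
  have r': "0 < r'" "r' \<le> e" "r' \<le> r / 2" "r' \<le> \<rho> / 2" using r \<rho>(1) e by (auto simp: r'_def)
  show ?thesis
  proof (intro exI[of _ F'] exI[of _ r'] conjI)
    show "cball F' r' \<subseteq> cball F r"
    proof
      fix G assume "G \<in> cball F' r'"
      then show "G \<in> cball F r"
        using dist_triangle[of F G F'] F'(2) r'(3) by (simp add: dist_commute)
    qed
    show "\<forall>G\<in>cball F' r'. det G = 1 \<longrightarrow> bact G None \<noteq> \<eta>"
    proof
      fix G assume "G \<in> cball F' r'"
      then have "dist F' G < \<rho>" using r'(4) \<rho>(1) by simp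
      then show "det G = 1 \<longrightarrow> bact G None \<noteq> \<eta>" using \<rho>(2) by simp
    qed
  qed (use F' r' in simp_all)
qed

text \<open>A Cantor diagonal argument: nested balls of frames avoid the \<open>n\<close>-th endpoint of a given list, and
  the uniform bounds on \<open>flow_dist\<close> pass to the limit.\<close>
lemma shadowing_endpoint_not_in_range:
  assumes U: "det U = 1" and cusp: "cusp_recurrent \<Gamma> (frame U)"
  shows "\<exists>G. det G = 1 \<and> frame G \<in> shadowing_vectors U \<and> bact G None \<notin> range (\<eta> :: nat \<Rightarrow> bdry)"
proof -
  let ?e = "\<lambda>n::nat. (1 / 2 :: real) ^ n"
  let ?P = "\<lambda>(n::nat) x. follows U (fst x) \<and> 0 < snd x \<and> snd x \<le> ?e n"
  let ?Q = "\<lambda>(n::nat) x y. cball (fst y) (snd y) \<subseteq> cball (fst x) (snd x) \<and>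
    (\<forall>t\<ge>0. flow_dist t (fst x) (fst y) \<le> ?e n) \<and> (\<forall>G\<in>cball (fst y) (snd y). det G = 1 \<longrightarrow> bact G None \<noteq> \<eta> n)"
  \<comment> \<open>The state of the recursion is a pair of a frame and a radius; passing from stage
    \<open>n\<close> to the next one excludes \<open>\<eta> n\<close>.\<close>
  have "\<exists>f. \<forall>n. ?P n (f n) \<and> ?Q n (f n) (f (Suc n))"
  proof (rule dependent_nat_choice)
    have "follows U U"
      unfolding follows_def
      by (intro bexI[of _ "mat 1"] exI[of _ 0]) (simp_all add: pm_iff one_in_Gamma up_def flip: mat_1_eq_mat22)
    then show "\<exists>x. ?P 0 x" by (intro exI[of _ "(U, 1)"]) simp
  next
    fix x :: "(real^2^2) \<times> real" and n assume x: "?P n x"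
    have e: "0 < ?e (Suc n)" by simp
    have fx: "follows U (fst x)" "0 < snd x" using x by simp_all
    from refine_avoiding[OF U cusp fx e, of "\<eta> n"]
    obtain F' r' where F': "follows U F'" "0 < r'" "r' \<le> ?e (Suc n)" "cball F' r' \<subseteq> cball (fst x) (snd x)"
        "\<forall>t\<ge>0. flow_dist t (fst x) F' \<le> ?e (Suc n)" "\<forall>G\<in>cball F' r'. det G = 1 \<longrightarrow> bact G None \<noteq> \<eta> n"
      by (elim exE conjE)
    have "\<forall>t\<ge>0. flow_dist t (fst x) F' \<le> ?e n"
    proof (intro allI impI)
      fix t :: real assume "0 \<le> t"
      then have "flow_dist t (fst x) F' \<le> ?e (Suc n)" using F'(5) by simp
      also have "\<dots> \<le> ?e n" by simp
      finally show "flow_dist t (fst x) F' \<le> ?e n" .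
    qed
    then show "\<exists>y. ?P (Suc n) y \<and> ?Q n x y"
      using F' by (intro exI[of _ "(F', r')"]) simp
  qed
  then obtain f where "\<forall>n. ?P n (f n) \<and> ?Q n (f n) (f (Suc n))" ..
  then have f: "\<And>n. ?P n (f n)" "\<And>n. ?Q n (f n) (f (Suc n))"
    by simp_all
  define F where "F n = fst (f n)" for n
  define B where "B n = cball (F n) (snd (f n))" for n
  have fol: "follows U (F n)" for n using f(1)[of n] by (simp add: F_def)
  have detF: "det (F n) = 1" for n using fol U by (rule det_follows)
  have near: "flow_dist t (F n) (F (Suc n)) \<le> ?e n" if "0 \<le> t" for n t
    using f(2)[of n] that by (simp add: F_def)
  have decr: "B n \<subseteq> B m" if "m \<le> n" for m n
    using that by (rule lift_Suc_antimono_le[rotated]) (use f(2) in \<open>simp add: B_def F_def\<close>)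
  have "\<Inter> (range B) \<noteq> {}"
  proof (rule compact_nest)
    show "compact (B n)" for n by (simp add: B_def)
    show "B n \<noteq> {}" for n using f(1)[of n] by (simp add: B_def)
  qed (rule decr)
  then obtain G where G: "\<And>n. G \<in> B n" by blast
  have "F \<longlonglongrightarrow> G"
  proof (rule metric_tendsto_imp_tendsto)
    show "(\<lambda>n. ?e n) \<longlonglongrightarrow> 0" by (rule LIMSEQ_power_zero) simp
    show "\<forall>\<^sub>F n in sequentially. dist (F n) G \<le> dist (?e n) 0"
    proof (rule always_eventually, rule allI)
      fix n
      show "dist (F n) G \<le> dist (?e n) 0"
        using G[of n] f(1)[of n] by (simp add: B_def)
    qed
  qed
  have detG: "det G = 1"
  proof (rule LIMSEQ_unique)
    have "(\<lambda>n. F n$1$1 * F n$2$2 - F n$1$2 * F n$2$1) \<longlonglongrightarrow> G$1$1 * G$2$2 - G$1$2 * G$2$1"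
      by (intro tendsto_intros tendsto_vec_nth \<open>F \<longlonglongrightarrow> G\<close>)
    then show "(\<lambda>n. det (F n)) \<longlonglongrightarrow> det G" by (simp add: det_2)
    show "(\<lambda>n. det (F n)) \<longlonglongrightarrow> 1" by (simp add: detF)
  qed
  \<comment> \<open>The geometric series in exact telescoping form, so that the induction closes;
    its tail from \<open>k\<close> on is at most \<open>2 * ?e k\<close>.\<close>
  have partial: "flow_dist t (F k) (F (k + j)) \<le> 2 * ?e k - 2 * ?e (k + j)" if t: "0 \<le> t" for t k j
  proof (induction j)
    case 0
    show ?case
      using flow_dist_pm_self[OF detF, of "mat 1" k t] by (simp add: pm_iff one_in_Gamma)
  next
    case (Suc j)
    have "flow_dist t (F k) (F (Suc (k + j))) \<le> flow_dist t (F k) (F (k + j)) + flow_dist t (F (k + j)) (F (Suc (k + j)))"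
      by (rule flow_dist_triangle[OF detF detF detF])
    also have "\<dots> \<le> (2 * ?e k - 2 * ?e (k + j)) + ?e (k + j)"
      using Suc near[OF t] by (rule add_mono)
    finally show ?case by simp
  qed
  have limit: "flow_dist t (F k) G \<le> 2 * ?e k" if t: "0 \<le> t" for t k
  proof (rule LIMSEQ_le_const)
    have "(\<lambda>j. flow_dist t (F (j + k)) G) \<longlonglongrightarrow> 0"
      by (rule LIMSEQ_ignore_initial_segment) (rule flow_dist_tendsto[OF detF detG \<open>F \<longlonglongrightarrow> G\<close>])
    from tendsto_add[OF tendsto_const[of "2 * ?e k"] this]
    show "(\<lambda>j. 2 * ?e k + flow_dist t (F (j + k)) G) \<longlonglongrightarrow> 2 * ?e k"
      by (simp only: add_0_right)
    show "\<exists>N. \<forall>j\<ge>N. flow_dist t (F k) G \<le> 2 * ?e k + flow_dist t (F (j + k)) G"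
    proof (intro exI allI impI)
      fix j
      have "flow_dist t (F k) G \<le> flow_dist t (F k) (F (k + j)) + flow_dist t (F (k + j)) G"
        by (rule flow_dist_triangle[OF detF detF detG])
      moreover have "0 \<le> ?e (k + j)" by simp
      ultimately have "flow_dist t (F k) G \<le> 2 * ?e k + flow_dist t (F (k + j)) G"
        using partial[OF t, of k j] by linarith
      then show "flow_dist t (F k) G \<le> 2 * ?e k + flow_dist t (F (j + k)) G"
        by (simp only: add.commute)
    qed
  qed
  \<comment> \<open>The frame \<open>F k\<close> is asymptotic to \<open>U\<close>, and
    \<open>G\<close> stays within \<open>2 * ?e k\<close> of \<open>F k\<close> for all nonnegative
    times; \<open>k\<close> is fixed before \<open>t\<close> tends to infinity.\<close>
  have "((\<lambda>t. flow_dist t U G) \<longlongrightarrow> 0) at_top"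
  proof (rule tendstoI)
    fix e :: real assume "0 < e"
    then obtain k where k: "?e k < e / 4"
      using real_arch_pow_inv[of "e / 4" "1 / 2"] by auto
    have "\<forall>\<^sub>F t in at_top. flow_dist t U (F k) < e / 2"
      using flow_dist_follows_tendsto[OF U fol] \<open>0 < e\<close> by (intro order_tendstoD(2)) auto
    then show "\<forall>\<^sub>F t in at_top. dist (flow_dist t U G) 0 < e"
      using eventually_ge_at_top[of 0]
    proof eventually_elim
      case (elim t)
      have "flow_dist t U G \<le> flow_dist t U (F k) + flow_dist t (F k) G"
        by (rule flow_dist_triangle[OF U detF detG])
      moreover have "flow_dist t (F k) G \<le> 2 * ?e k" using elim by (intro limit)
      moreover have "0 \<le> flow_dist t U G"
        using U detG by (intro d1S_nonneg) (simp_all add: det_mult_1)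
      ultimately show ?case using elim k by simp
    qed
  qed
  then have "frame G \<in> shadowing_vectors U"
    using frame_shadowing_iff[OF U detG] by simp
  \<comment> \<open>The value \<open>\<eta> n\<close> is avoided on the ball of index
    \<open>Suc n\<close>.\<close>
  moreover have "bact G None \<noteq> \<eta> n" for n
    using f(2)[of n] G[of "Suc n"] detG by (simp add: B_def F_def)
  ultimately show ?thesis using detG by (intro exI[of _ G]) auto
qed

text \<open>If there were countably many endpoints, an enumeration of them could serve as the list
  to be avoided.\<close>

lemma uncountable_shadowing_endpoints:
  assumes U: "det U = 1" and cusp: "cusp_recurrent \<Gamma> (frame U)"
  shows "uncountable (vplus ` shadowing_vectors U)"
proof
  assume c: "countable (vplus ` shadowing_vectors U)"
  from shadowing_endpoint_not_in_range[OF U cusp, of "from_nat_into (vplus ` shadowing_vectors U)"]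
  obtain G where G: "det G = 1" "frame G \<in> shadowing_vectors U"
      "bact G None \<notin> range (from_nat_into (vplus ` shadowing_vectors U))"
    by (elim exE conjE)
  then have "vplus (frame G) \<in> vplus ` shadowing_vectors U" by simp
  then have "vplus (frame G) \<in> range (from_nat_into (vplus ` shadowing_vectors U))"
    using c by (metis from_nat_into_surj rangeI)
  then show False using G by (simp add: vplus_frame)
qed

section \<open>Stable horocycles in the quotient and their endpoints\<close>

lemma own_orbit: "v \<in> T1H \<Longrightarrow> v \<in> orbit \<Gamma> v"
proof -
  assume "v \<in> T1H"
  then obtain F where "det F = 1" "v = frame F" by (rule T1H_imp_frame)
  then have "v = tact (mat 1) v" by (simp add: tact_frame)
  then show ?thesis unfolding orbit_def using one_in_Gamma by (rule image_eqI)
qed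

lemma orbit_in_own_HssS: "v \<in> T1H \<Longrightarrow> orbit \<Gamma> v \<in> HssS \<Gamma> v"
  unfolding HssS_def using T1H_imp_frame[of v] in_own_Hss by (intro imageI) metis

lemma orbit_in_HssS_imp_endpoint:
  assumes w: "w \<in> T1H" and "orbit \<Gamma> w \<in> HssS \<Gamma> v"
  shows "\<exists>A\<in>\<Gamma>. vplus w = bact A (vplus v)"
proof -
  obtain x where x: "x \<in> Hss v" "orbit \<Gamma> w = orbit \<Gamma> x"
    using assms(2) by (auto simp: HssS_def)
  have "x \<in> T1H" using x(1) by (simp add: Hss_def)
  then obtain F where F: "det F = 1" "x = frame F"
    by (rule T1H_imp_frame)
  obtain A where A: "A \<in> \<Gamma>" "w = tact A x"
    using own_orbit[OF w] x(2) by (auto simp: orbit_def)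
  have "vplus w = bact A (vplus x)"
    using A F det_Gamma[OF A(1)] by (simp add: tact_frame vplus_frame bact_mult det_mult_1)
  also have "vplus x = vplus v" using x(1) by (simp add: Hss_def)
  finally show ?thesis using A(1) by blast
qed

text \<open>A stable horocycle in the quotient determines the endpoint up to the group only. With
  one representative for each horocycle, all endpoints lie in a countable union of countable group
  orbits.\<close>

lemma countable_vplus_image:
  assumes V: "V \<subseteq> T1H" and c: "countable (HssS \<Gamma> ` V)"
  shows "countable (vplus ` V)"
proof -
  let ?r = "inv_into V (HssS \<Gamma>)"
  have "vplus ` V \<subseteq> (\<Union>S\<in>HssS \<Gamma> ` V. (\<lambda>A. bact A (vplus (?r S))) ` \<Gamma>)"
  proof
    fix \<xi> assume "\<xi> \<in> vplus ` V"
    then obtain w where w: "w \<in> V" "\<xi> = vplus w" by (rule imageE)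
    then have wV: "HssS \<Gamma> w \<in> HssS \<Gamma> ` V" by simp
    have "orbit \<Gamma> w \<in> HssS \<Gamma> (?r (HssS \<Gamma> w))"
      unfolding f_inv_into_f[OF wV] using V w(1) by (intro orbit_in_own_HssS) (rule subsetD)
    from orbit_in_HssS_imp_endpoint[OF subsetD[OF V w(1)] this]
    obtain A where A: "A \<in> \<Gamma>" "vplus w = bact A (vplus (?r (HssS \<Gamma> w)))"
      by (rule bexE)
    show "\<xi> \<in> (\<Union>S\<in>HssS \<Gamma> ` V. (\<lambda>A. bact A (vplus (?r S))) ` \<Gamma>)"
      unfolding w(2) A(2) by (intro UN_I[OF wV] imageI A(1))
  qed
  moreover have "countable (\<Union>S\<in>HssS \<Gamma> ` V. (\<lambda>A. bact A (vplus (?r S))) ` \<Gamma>)"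
    by (intro countable_UN c countable_image countable_Gamma)
  ultimately show ?thesis
    by (rule countable_subset)
qed

lemma Hss_shadowing:
  assumes U: "det U = 1" and v: "v \<in> shadowing_vectors U" and w: "w \<in> Hss v"
  shows "w \<in> shadowing_vectors U"
proof -
  obtain F where F: "det F = 1" "v = frame F"
    using v T1H_imp_frame[of v] by (auto simp: shadowing_vectors_def)
  from Hss_frame_imp[OF F(1) w[unfolded F(2)]] obtain s where s: "w = frame (F ** up s)" ..
  have det: "det (F ** up s) = 1" using F by (simp add: det_mult_1)
  have "((\<lambda>t. flow_dist t U F) \<longlongrightarrow> 0) at_top"
    using v F frame_shadowing_iff[OF U F(1)] by simp
  from tendsto_add[OF this flow_dist_up_tendsto[OF F(1), of s]]
  have sum: "((\<lambda>t. flow_dist t U F + flow_dist t F (F ** up s)) \<longlongrightarrow> 0) at_top"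
    by (simp only: add_0_right)
  have "((\<lambda>t. flow_dist t U (F ** up s)) \<longlongrightarrow> 0) at_top"
  proof (rule tendsto_sandwich[OF _ _ tendsto_const sum])
    show "\<forall>\<^sub>F t in at_top. 0 \<le> flow_dist t U (F ** up s)"
      using U det by (intro always_eventually allI d1S_nonneg) (simp_all add: det_mult_1)
    show "\<forall>\<^sub>F t in at_top. flow_dist t U (F ** up s) \<le> flow_dist t U F + flow_dist t F (F ** up s)"
      by (intro always_eventually allI flow_dist_triangle[OF U F(1) det])
  qed
  then show ?thesis
    using frame_shadowing_iff[OF U det] s by simp
qed

lemma own_shadowing:
  assumes "det U = 1"
  shows "frame U \<in> shadowing_vectors U"
proof -
  have "U ** up 0 = U" by (simp add: up_def flip: mat_1_eq_mat22)
  then show ?thesis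
    using flow_dist_up_tendsto[OF assms, of 0] frame_shadowing_iff[OF assms assms] by simp
qed

end

theorem theorem2:
  fixes \<Gamma> :: "(real^2^2) set" and u :: "complex \<times> complex"
  assumes "fuchsian \<Gamma>" and "torsion_free \<Gamma>"
    and "\<exists>A\<in>\<Gamma>. parabolic A"
    and "u \<in> T1H" and "cusp_recurrent \<Gamma> u"
  shows "HssS \<Gamma> u \<subset> WssS \<Gamma> u \<and>
         (\<exists>V. V \<subseteq> T1H \<and> uncountable (HssS \<Gamma> ` V) \<and> WssS \<Gamma> u = \<Union> (HssS \<Gamma> ` V))"
proof -
  interpret fuchsian_group \<Gamma> using assms(1) by unfold_locales
  obtain U where U: "det U = 1" "u = frame U"
    using assms(4) by (rule T1H_imp_frame)
  have cusp: "cusp_recurrent \<Gamma> (frame U)" using assms(5) U by simp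
  let ?V = "shadowing_vectors U"
  have V: "?V \<subseteq> T1H" by (auto simp: shadowing_vectors_def)
  have W: "WssS \<Gamma> u = orbit \<Gamma> ` ?V"
    by (auto simp: WssS_def shadowing_vectors_def U(2))
  have H: "HssS \<Gamma> v \<subseteq> WssS \<Gamma> u" if "v \<in> ?V" for v
    using Hss_shadowing[OF U(1) that] by (auto simp: HssS_def W)
  have unc: "uncountable (HssS \<Gamma> ` ?V)"
    using countable_vplus_image[OF V] uncountable_shadowing_endpoints[OF U(1) cusp] by (rule contrapos_nn[rotated])
  have un: "WssS \<Gamma> u = \<Union> (HssS \<Gamma> ` ?V)"
  proof
    show "WssS \<Gamma> u \<subseteq> \<Union> (HssS \<Gamma> ` ?V)"
      using V orbit_in_own_HssS unfolding W by blast
    show "\<Union> (HssS \<Gamma> ` ?V) \<subseteq> WssS \<Gamma> u"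
      using H by blast
  qed
  \<comment> \<open>Equality would place all endpoints in the single group orbit of
    \<open>vplus u\<close>.\<close>
  have "HssS \<Gamma> u \<noteq> WssS \<Gamma> u"
  proof
    assume eq: "HssS \<Gamma> u = WssS \<Gamma> u"
    have "vplus ` ?V \<subseteq> (\<lambda>A. bact A (vplus u)) ` \<Gamma>"
    proof
      fix \<xi> assume "\<xi> \<in> vplus ` ?V"
      then obtain v where v: "v \<in> ?V" "\<xi> = vplus v" by (rule imageE)
      have "orbit \<Gamma> v \<in> HssS \<Gamma> u" using v eq W by simp
      from orbit_in_HssS_imp_endpoint[OF subsetD[OF V v(1)] this]
      show "\<xi> \<in> (\<lambda>A. bact A (vplus u)) ` \<Gamma>"
        unfolding v(2) by blast
    qed
    then have "countable (vplus ` ?V)"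
      by (rule countable_subset) (intro countable_image countable_Gamma)
    then show False using uncountable_shadowing_endpoints[OF U(1) cusp] by simp
  qed
  moreover have "HssS \<Gamma> u \<subseteq> WssS \<Gamma> u"
    using H own_shadowing[OF U(1)] U(2) by simp
  ultimately have "HssS \<Gamma> u \<subset> WssS \<Gamma> u" by (intro psubsetI)
  then show ?thesis
    using V unc un by (intro conjI exI[of _ ?V])
qed

end
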